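(* There is a universal constant $C>0$ and a deterministic polynomial-time algorithm which, given a positive semidefinite matrix $B\in\mathbb{R}^{n\times n}$ and a matrix $Q\in\mathbb{R}^{n\times n}$ whose columns all have Euclidean norm at most $1$, returns $x\in\{\pm1\}^n$ such that \[ \|Qx\|_B\le C\sqrt{\operatorname{Tr}B}. \]
   Context: For a positive semidefinite $B\in\mathbb{R}^{n\times n}$ and $z\in\mathbb{R}^n$, $\|z\|_B:=\sqrt{\langle z,Bz\rangle}$. *)

theory Defs
  imports "Jordan_Normal_Form.Matrix" "HOL-Computational_Algebra.Polynomial"
begin

section \<open>Linear algebra\<close>

definition euclid_norm :: "real vec \<Rightarrow> real" where
  "euclid_norm v = sqrt (v \<bullet> v)"

definition trace_mat :: "real mat \<Rightarrow> real" where
  "trace_mat A = (\<Sum>i<dim_row A. A $$ (i, i))"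

definition psd :: "nat \<Rightarrow> real mat \<Rightarrow> bool" where
  "psd n B \<longleftrightarrow> B \<in> carrier_mat n n \<and> transpose_mat B = B \<and>
     (\<forall>z \<in> carrier_vec n. 0 \<le> z \<bullet> (B *\<^sub>v z))"

definition norm_wrt :: "real mat \<Rightarrow> real vec \<Rightarrow> real" where
  "norm_wrt B z = sqrt (z \<bullet> (B *\<^sub>v z))"

definition sign_vecs :: "nat \<Rightarrow> real vec set" where
  "sign_vecs n = {x \<in> carrier_vec n. \<forall>i<n. x $ i = 1 \<or> x $ i = -1}"

section \<open>Algorithms on real inputs\<close>

text \<open>
  Deterministic programs for a real random access machine (Blum--Shub--Smale style): real cells
  hold exact real numbers, and every field operation and comparison has unit cost.

  The power of the machine is limited to the usual one. The only real constants are integers, so no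
  information can be hidden in a program. There is no rounding, no root extraction, and no
  conversion from real numbers to natural numbers. Natural numbers serve as counters and array
  indices; they are not multiplied, so in time \<open>t\<close> they grow by at most \<open>O(t)\<close> bits.
\<close>

datatype iexp = IConst nat | IVar nat | IAdd iexp iexp | ISub iexp iexp

text \<open>\<open>Cell a i j\<close> is the entry at position \<open>(i, j)\<close> of the two-dimensional real array number \<open>a\<close>.\<close>

datatype rexp = RConst int | Cell nat iexp iexp
  | RAdd rexp rexp | RSub rexp rexp | RMul rexp rexp | RDiv rexp rexp

datatype bexp = ILess iexp iexp | RLess rexp rexp | BNot bexp | BAnd bexp bexp

datatype com = Skip
  | ISet nat iexp
  | RSet nat iexp iexp rexp
  | Seq com com
  | Cond bexp com com
  | Loop bexp com

record state =
  ivar :: "nat \<Rightarrow> nat"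
  cell :: "nat \<Rightarrow> nat \<Rightarrow> nat \<Rightarrow> real"

text \<open>Subtraction of indices is truncated, and division by zero yields zero. The latter adds no
  power, as a program can test for zero.\<close>

fun ival :: "iexp \<Rightarrow> state \<Rightarrow> nat" where
  "ival (IConst k) s = k"
| "ival (IVar v) s = ivar s v"
| "ival (IAdd a b) s = ival a s + ival b s"
| "ival (ISub a b) s = ival a s - ival b s"

fun rval :: "rexp \<Rightarrow> state \<Rightarrow> real" where
  "rval (RConst k) s = of_int k"
| "rval (Cell a i j) s = cell s a (ival i s) (ival j s)"
| "rval (RAdd a b) s = rval a s + rval b s"
| "rval (RSub a b) s = rval a s - rval b s"
| "rval (RMul a b) s = rval a s * rval b s"
| "rval (RDiv a b) s = rval a s / rval b s"

fun bval :: "bexp \<Rightarrow> state \<Rightarrow> bool" where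
  "bval (ILess a b) s \<longleftrightarrow> ival a s < ival b s"
| "bval (RLess a b) s \<longleftrightarrow> rval a s < rval b s"
| "bval (BNot b) s \<longleftrightarrow> \<not> bval b s"
| "bval (BAnd a b) s \<longleftrightarrow> bval a s \<and> bval b s"

fun icost :: "iexp \<Rightarrow> nat" where
  "icost (IConst k) = 1"
| "icost (IVar v) = 1"
| "icost (IAdd a b) = icost a + icost b + 1"
| "icost (ISub a b) = icost a + icost b + 1"

fun rcost :: "rexp \<Rightarrow> nat" where
  "rcost (RConst k) = 1"
| "rcost (Cell a i j) = icost i + icost j + 1"
| "rcost (RAdd a b) = rcost a + rcost b + 1"
| "rcost (RSub a b) = rcost a + rcost b + 1"
| "rcost (RMul a b) = rcost a + rcost b + 1"
| "rcost (RDiv a b) = rcost a + rcost b + 1"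

fun bcost :: "bexp \<Rightarrow> nat" where
  "bcost (ILess a b) = icost a + icost b + 1"
| "bcost (RLess a b) = rcost a + rcost b + 1"
| "bcost (BNot b) = bcost b + 1"
| "bcost (BAnd a b) = bcost a + bcost b + 1"

definition set_ivar :: "nat \<Rightarrow> nat \<Rightarrow> state \<Rightarrow> state" where
  "set_ivar v k s = s\<lparr>ivar := (ivar s)(v := k)\<rparr>"

definition set_cell :: "nat \<Rightarrow> nat \<Rightarrow> nat \<Rightarrow> real \<Rightarrow> state \<Rightarrow> state" where
  "set_cell a i j r s =
     s\<lparr>cell := (cell s)(a := (cell s a)(i := (cell s a i)(j := r)))\<rparr>"

text \<open>\<open>exec c s t s'\<close>: started in state \<open>s\<close>, the program \<open>c\<close> halts in state \<open>s'\<close> after performing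
  exactly \<open>t\<close> operations. Programs that run forever have no final state.\<close>

inductive exec :: "com \<Rightarrow> state \<Rightarrow> nat \<Rightarrow> state \<Rightarrow> bool" where
  Skip: "exec Skip s 1 s"
| ISet: "exec (ISet v e) s (icost e + 1) (set_ivar v (ival e s) s)"
| RSet: "exec (RSet a i j e) s (icost i + icost j + rcost e + 1)
           (set_cell a (ival i s) (ival j s) (rval e s) s)"
| Seq: "exec c1 s1 t1 s2 \<Longrightarrow> exec c2 s2 t2 s3 \<Longrightarrow> exec (Seq c1 c2) s1 (t1 + t2) s3"
| CondTrue: "bval b s \<Longrightarrow> exec c1 s t s' \<Longrightarrow> exec (Cond b c1 c2) s (bcost b + t) s'"
| CondFalse: "\<not> bval b s \<Longrightarrow> exec c2 s t s' \<Longrightarrow> exec (Cond b c1 c2) s (bcost b + t) s'"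
| LoopFalse: "\<not> bval b s \<Longrightarrow> exec (Loop b c) s (bcost b) s"
| LoopTrue: "bval b s1 \<Longrightarrow> exec c s1 t1 s2 \<Longrightarrow> exec (Loop b c) s2 t2 s3 \<Longrightarrow>
    exec (Loop b c) s1 (bcost b + t1 + t2) s3"

inductive_cases SkipE: "exec Skip s t s'"
  and ISetE: "exec (ISet v e) s t s'"
  and RSetE: "exec (RSet a i j e) s t s'"
  and SeqE: "exec (Seq c1 c2) s t s'"
  and CondE: "exec (Cond b c1 c2) s t s'"
  and LoopE: "exec (Loop b c) s t s'"

lemma exec_deterministic:
  "exec c s t s' \<Longrightarrow> exec c s u s'' \<Longrightarrow> u = t \<and> s'' = s'"
proof (induction arbitrary: u s'' rule: exec.induct)
  case (Skip s)
  then show ?case by (rule SkipE) simp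
next
  case (ISet v e s)
  then show ?case by (rule ISetE) simp
next
  case (RSet a i j e s)
  then show ?case by (rule RSetE) simp
next
  case (Seq c1 s1 t1 s2 c2 t2 s3)
  from Seq.prems show ?case
  proof (rule SeqE)
    fix v1 r v2
    assume u: "u = v1 + v2" and 1: "exec c1 s1 v1 r" and 2: "exec c2 r v2 s''"
    note fst = Seq.IH(1)[OF 1]
    with 2 have "exec c2 s2 v2 s''" by simp
    from Seq.IH(2)[OF this] fst u show ?thesis by simp
  qed
next
  case (CondTrue b s c1 t s' c2)
  from CondTrue.prems obtain v where v: "u = bcost b + v" "exec c1 s v s''"
    by (rule CondE) (use CondTrue.hyps in simp_all)
  show ?case using CondTrue.IH[OF v(2)] v(1) by simp
next
  case (CondFalse b s c2 t s' c1)
  from CondFalse.prems obtain v where v: "u = bcost b + v" "exec c2 s v s''"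
    by (rule CondE) (use CondFalse.hyps in simp_all)
  show ?case using CondFalse.IH[OF v(2)] v(1) by simp
next
  case (LoopFalse b s c)
  from LoopFalse.prems show ?case by (rule LoopE) (use LoopFalse.hyps in simp_all)
next
  case (LoopTrue b s1 c t1 s2 t2 s3)
  from LoopTrue.prems show ?case
  proof (rule LoopE)
    fix v1 r v2
    assume u: "u = bcost b + v1 + v2" and 1: "exec c s1 v1 r" and 2: "exec (Loop b c) r v2 s''"
    note fst = LoopTrue.IH(1)[OF 1]
    with 2 have "exec (Loop b c) s2 v2 s''" by simp
    from LoopTrue.IH(2)[OF this] fst u show ?thesis by simp
  qed (use LoopTrue.hyps in simp)
qed

text \<open>Input convention: index variable 0 holds the dimension and arrays 0 and 1 hold the two
  matrices; everything else is zero. The output is read off column 0 of array 2.\<close>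

definition input_state :: "nat \<Rightarrow> real mat \<Rightarrow> real mat \<Rightarrow> state" where
  "input_state n B Q =
     \<lparr>ivar = (\<lambda>v. if v = 0 then n else 0),
      cell = (\<lambda>a i j. if i < n \<and> j < n
                      then (if a = 0 then B $$ (i, j) else if a = 1 then Q $$ (i, j) else 0)
                      else 0)\<rparr>"

definition output_vec :: "nat \<Rightarrow> state \<Rightarrow> real vec" where
  "output_vec n s = vec n (\<lambda>i. cell s 2 i 0)"

definition returns_within :: "com \<Rightarrow> nat \<Rightarrow> nat \<Rightarrow> real mat \<Rightarrow> real mat \<Rightarrow> real vec \<Rightarrow> bool" where
  "returns_within c m n B Q x \<longleftrightarrow>
     (\<exists>t s. exec c (input_state n B Q) t s \<and> t \<le> m \<and> x = output_vec n s)"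

text \<open>The program \<open>c\<close> solves, in time polynomial in the dimension \<open>n\<close>, the following problem: given
  real \<open>n \<times> n\<close> matrices \<open>B\<close> and \<open>Q\<close> with \<open>inst n B Q\<close>, find a vector \<open>x\<close> with \<open>sol n B Q x\<close>.
  One program and one polynomial serve all dimensions.\<close>

definition solves_in_poly_time ::
  "com \<Rightarrow> (nat \<Rightarrow> real mat \<Rightarrow> real mat \<Rightarrow> bool) \<Rightarrow>
     (nat \<Rightarrow> real mat \<Rightarrow> real mat \<Rightarrow> real vec \<Rightarrow> bool) \<Rightarrow> bool" where
  "solves_in_poly_time c inst sol \<longleftrightarrow>
     (\<exists>p :: nat poly. \<forall>n. \<forall>B \<in> carrier_mat n n. \<forall>Q \<in> carrier_mat n n.
        inst n B Q \<longrightarrow> (\<exists>x. returns_within c (poly p n) n B Q x \<and> sol n B Q x))"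

end

(*
  The walk of Gram and Schmidt (Bansal, Dadush, Garg, Lovett; Harshaw, Savje, Spielman, Zhang),
  derandomised by a potential function.

  Put M = Q^T B Q and G = I + Q^T Q, so that G has diagonal entries at most 2. The point x moves from
  0 to a vertex of the cube; A is the set of coordinates still alive and H is the inverse of the
  block G_AA, padded by zeros. The pivot p is the least alive coordinate, h is column p of H, and the
  potential is
    x^T M x + 2 Tr (M H) - x_p^2 (h^T M h) / H_pp^2.
  Along the line x + d h the potential is affine in d, because the quadratic terms cancel, so one of
  the two directions does not increase it. Following it until a coordinate j becomes +1 or -1 and
  dropping j from A changes H by a rank one matrix, which does not increase the potential either:
  Tr (M H) decreases by (h_j^T M h_j) / H_jj, which by Jensen's inequality and H_pp >= 1/2 pays for
  the change of the last term. Initially the potential is 2 Tr (M G^-1) <= 2 Tr B, and at the end it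
  is x^T M x.

  Neither G^-1 nor its updates need square roots: G^-1 is built from the rows of Q by rank one
  updates. Adding I to Q^T Q keeps all blocks invertible at the price of the factor 2.
*)

theory Submission
  imports Defs
begin

section \<open>Total correctness within a syntactic time bound\<close>

text \<open>The bound presumes that every loop makes at most \<open>n\<close> iterations each time it is entered.\<close>

fun time_bound :: "com \<Rightarrow> nat \<Rightarrow> nat" where
  "time_bound Skip n = 1"
| "time_bound (ISet v e) n = icost e + 1"
| "time_bound (RSet a i j e) n = icost i + icost j + rcost e + 1"
| "time_bound (Seq c d) n = time_bound c n + time_bound d n"
| "time_bound (Cond b c d) n = bcost b + time_bound c n + time_bound d n"
| "time_bound (Loop b c) n = n * (bcost b + time_bound c n) + bcost b"

text \<open>\<open>time_bound\<close> adds up both branches of a conditional instead of taking their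
  maximum, because a maximum of two polynomials need not be a polynomial.\<close>

lemma time_bound_poly: "\<exists>p :: nat poly. \<forall>n. poly p n = time_bound c n"
proof (induction c)
  case (Seq c d)
  then obtain p q :: "nat poly" where
    "\<forall>n. poly p n = time_bound c n" "\<forall>n. poly q n = time_bound d n"
    by blast
  then show ?case by (intro exI[of _ "p + q"]) simp
next
  case (Cond b c d)
  then obtain p q :: "nat poly" where
    "\<forall>n. poly p n = time_bound c n" "\<forall>n. poly q n = time_bound d n"
    by blast
  then show ?case by (intro exI[of _ "[:bcost b:] + p + q"]) simp
next
  case (Loop b c)
  then obtain p :: "nat poly" where "\<forall>n. poly p n = time_bound c n" by blast
  then show ?case by (intro exI[of _ "[:0, 1:] * ([:bcost b:] + p) + [:bcost b:]"]) simp
qed (auto intro: exI[of _ "[:k:]" for k])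

section \<open>Frame conditions: what a program can change\<close>

fun mod_ivars :: "com \<Rightarrow> nat set" where
  "mod_ivars Skip = {}"
| "mod_ivars (ISet v e) = {v}"
| "mod_ivars (RSet a i j e) = {}"
| "mod_ivars (Seq c d) = mod_ivars c \<union> mod_ivars d"
| "mod_ivars (Cond b c d) = mod_ivars c \<union> mod_ivars d"
| "mod_ivars (Loop b c) = mod_ivars c"

fun mod_arrays :: "com \<Rightarrow> nat set" where
  "mod_arrays Skip = {}"
| "mod_arrays (ISet v e) = {}"
| "mod_arrays (RSet a i j e) = {a}"
| "mod_arrays (Seq c d) = mod_arrays c \<union> mod_arrays d"
| "mod_arrays (Cond b c d) = mod_arrays c \<union> mod_arrays d"
| "mod_arrays (Loop b c) = mod_arrays c"

definition agree_off :: "nat set \<Rightarrow> nat set \<Rightarrow> state \<Rightarrow> state \<Rightarrow> bool" where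
  "agree_off V A s s' \<longleftrightarrow>
     (\<forall>v. v \<notin> V \<longrightarrow> ivar s' v = ivar s v) \<and> (\<forall>a. a \<notin> A \<longrightarrow> cell s' a = cell s a)"

lemma ivar_set_ivar [simp]: "ivar (set_ivar v k s) w = (if w = v then k else ivar s w)"
  and cell_set_ivar [simp]: "cell (set_ivar v k s) = cell s"
  and ivar_set_cell [simp]: "ivar (set_cell a i j r s) = ivar s"
  and cell_set_cell [simp]: "cell (set_cell a i j r s) a' i' j' =
        (if a' = a \<and> i' = i \<and> j' = j then r else cell s a' i' j')"
  by (auto simp: set_ivar_def set_cell_def)

lemma exec_agree_off: "exec c s t s' \<Longrightarrow> agree_off (mod_ivars c) (mod_arrays c) s s'"
  by (induction rule: exec.induct) (auto simp: agree_off_def fun_eq_iff)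

lemma agree_off_refl [simp]: "agree_off V A s s"
  by (simp add: agree_off_def)

lemma agree_off_trans:
  "agree_off V A s s' \<Longrightarrow> agree_off V A s' s'' \<Longrightarrow> agree_off V A s s''"
  by (simp add: agree_off_def)

lemma agree_off_mono:
  "agree_off V A s s' \<Longrightarrow> V \<subseteq> V' \<Longrightarrow> A \<subseteq> A' \<Longrightarrow> agree_off V' A' s s'"
  by (auto simp: agree_off_def)

lemma agree_off_ivar: "agree_off V A s s' \<Longrightarrow> v \<notin> V \<Longrightarrow> ivar s' v = ivar s v"
  by (simp add: agree_off_def)

section \<open>Proof rules for total correctness within the time bound\<close>

definition runs :: "nat \<Rightarrow> com \<Rightarrow> state \<Rightarrow> (state \<Rightarrow> bool) \<Rightarrow> bool" where
  "runs n c s P \<longleftrightarrow> (\<exists>t s'. exec c s t s' \<and> t \<le> time_bound c n \<and> P s')"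

lemma runs_frame:
  assumes "runs n c s P"
    and "\<And>s'. agree_off (mod_ivars c) (mod_arrays c) s s' \<Longrightarrow> P s' \<Longrightarrow> R s'"
  shows "runs n c s R"
  using assms exec_agree_off unfolding runs_def by blast

lemma runs_ISet: "P (set_ivar v (ival e s) s) \<Longrightarrow> runs n (ISet v e) s P"
  unfolding runs_def by (force intro: exec.ISet)

lemma runs_RSet: "P (set_cell a (ival i s) (ival j s) (rval e s) s) \<Longrightarrow> runs n (RSet a i j e) s P"
  unfolding runs_def by (force intro: exec.RSet)

lemma runs_Skip: "P s \<Longrightarrow> runs n Skip s P"
  unfolding runs_def by (force intro: exec.Skip)

text \<open>The continuation also learns what \<open>c\<close> leaves unchanged, so that the
  intermediate assertion \<open>R\<close> only has to describe what \<open>c\<close>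
  computes.\<close>

lemma runs_Seq:
  assumes "runs n c s R" and "\<And>s'. R s' \<Longrightarrow> agree_off (mod_ivars c) (mod_arrays c) s s' \<Longrightarrow> runs n d s' P"
  shows "runs n (Seq c d) s P"
proof -
  from assms(1) obtain t s' where 1: "exec c s t s'" "t \<le> time_bound c n" "R s'"
    unfolding runs_def by blast
  from assms(2)[OF 1(3) exec_agree_off[OF 1(1)]] obtain t' s'' where
    2: "exec d s' t' s''" "t' \<le> time_bound d n" "P s''"
    unfolding runs_def by blast
  from exec.Seq[OF 1(1) 2(1)] 1 2 show ?thesis
    unfolding runs_def by (force intro: add_mono)
qed

lemma runs_Cond:
  assumes "bval b s \<Longrightarrow> runs n c s P" "\<not> bval b s \<Longrightarrow> runs n d s P"
  shows "runs n (Cond b c d) s P"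
proof (cases "bval b s")
  case True
  with assms obtain t s' where "exec c s t s'" "t \<le> time_bound c n" "P s'"
    unfolding runs_def by blast
  with exec.CondTrue[OF True] show ?thesis
    unfolding runs_def by (intro exI[of _ "bcost b + t"] exI[of _ s']) auto
next
  case False
  with assms obtain t s' where "exec d s t s'" "t \<le> time_bound d n" "P s'"
    unfolding runs_def by blast
  with exec.CondFalse[OF False] show ?thesis
    unfolding runs_def by (intro exI[of _ "bcost b + t"] exI[of _ s']) auto
qed

text \<open>The index \<open>m\<close> of the invariant is a variant: every iteration lowers it,
  possibly by more than one, and it starts at \<open>n\<close> or below. So the number of iterations
  stays within the \<open>n\<close> that \<open>time_bound\<close> charges.\<close>

lemma runs_Loop:
  assumes "I m s" "m \<le> n"
    and step: "\<And>m s. I m s \<Longrightarrow> bval b s \<Longrightarrow> \<exists>m'<m. runs n c s (I m')"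
  shows "runs n (Loop b c) s (\<lambda>s'. \<not> bval b s' \<and> (\<exists>m'. I m' s'))"
proof -
  let ?T = "bcost b + time_bound c n"
  \<comment> \<open>The induction needs a time bound in terms of the current variant; it is relaxed
    to \<open>n\<close> only at the end.\<close>
  have "\<exists>t s'. exec (Loop b c) s t s' \<and> t \<le> m * ?T + bcost b \<and> \<not> bval b s' \<and> (\<exists>m'. I m' s')"
    using \<open>I m s\<close>
  proof (induction m arbitrary: s rule: less_induct)
    case (less m)
    show ?case
    proof (cases "bval b s")
      case True
      with step less.prems obtain m' where "m' < m" "runs n c s (I m')" by blast
      then obtain t s' where 1: "exec c s t s'" "t \<le> time_bound c n" "I m' s'"
        unfolding runs_def by blast
      from less.IH[OF \<open>m' < m\<close> 1(3)] obtain t' s'' where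
        2: "exec (Loop b c) s' t' s''" "t' \<le> m' * ?T + bcost b" "\<not> bval b s''" "\<exists>m'. I m' s''"
        by blast
      from \<open>m' < m\<close> have "Suc m' * ?T \<le> m * ?T" by (intro mult_right_mono) auto
      then have "bcost b + t + t' \<le> m * ?T + bcost b" using 1(2) 2(2) by simp
      with exec.LoopTrue[OF True 1(1) 2(1)] 2 show ?thesis by blast
    next
      case False
      with exec.LoopFalse[OF False] less.prems show ?thesis
        by (intro exI[of _ "bcost b"] exI[of _ s]) auto
    qed
  qed
  moreover have "m * ?T \<le> n * ?T" using \<open>m \<le> n\<close> by (intro mult_right_mono) auto
  ultimately show ?thesis unfolding runs_def by (fastforce intro: order_trans)
qed

text \<open>The limit is index variable 0, the dimension. A body that changes neither the counter
  nor this variable is thus run exactly as often as \<open>time_bound\<close> allows.\<close>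

definition For :: "nat \<Rightarrow> com \<Rightarrow> com" where
  "For v c = Seq (ISet v (IConst 0))
     (Loop (ILess (IVar v) (IVar 0)) (Seq c (ISet v (IAdd (IVar v) (IConst 1)))))"

lemma mod_For [simp]:
  "mod_ivars (For v c) = insert v (mod_ivars c)" "mod_arrays (For v c) = mod_arrays c"
  by (auto simp: For_def)

text \<open>The invariant receives the iteration number as an argument and, by
  \<open>stable\<close>, does not depend on the counter variable itself; so it survives the
  initialisation and the increments. The frame condition relative to the state before the loop is
  carried along with it.\<close>

lemma runs_For:
  assumes n: "ivar s 0 = n" and v: "v \<noteq> 0" "v \<notin> mod_ivars c" "0 \<notin> mod_ivars c"
    and init: "I 0 s"
    and stable: "\<And>k m s'. I k s' \<Longrightarrow> I k (set_ivar v m s')"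
    and step: "\<And>k s'. k < n \<Longrightarrow> ivar s' v = k \<Longrightarrow>
      agree_off (insert v (mod_ivars c)) (mod_arrays c) s s' \<Longrightarrow> I k s' \<Longrightarrow> runs n c s' (I (Suc k))"
    and post: "\<And>s'. agree_off (insert v (mod_ivars c)) (mod_arrays c) s s' \<Longrightarrow> I n s' \<Longrightarrow> P s'"
  shows "runs n (For v c) s P"
proof -
  let ?agree = "agree_off (insert v (mod_ivars c)) (mod_arrays c)"
  \<comment> \<open>The variant \<open>m\<close> counts the iterations that are left, so the counter
    is \<open>n - m\<close>.\<close>
  define J where "J m s' \<longleftrightarrow> m \<le> n \<and> ivar s' v = n - m \<and> ?agree s s' \<and> I (n - m) s'" for m s'
  let ?s0 = "set_ivar v 0 s"
  let ?loop = "Loop (ILess (IVar v) (IVar 0)) (Seq c (ISet v (IAdd (IVar v) (IConst 1))))"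
  have "runs n ?loop ?s0 (\<lambda>s'. \<not> bval (ILess (IVar v) (IVar 0)) s' \<and> (\<exists>m'. J m' s'))"
  proof (rule runs_Loop[where m = n])
    show "J n ?s0" using init stable by (simp add: J_def agree_off_def)
  next
    fix m s' assume J: "J m s'" and b: "bval (ILess (IVar v) (IVar 0)) s'"
    have ag: "?agree s s'" using J by (simp add: J_def)
    then have "ivar s' 0 = n" using n v agree_off_ivar[OF ag, of 0] by simp
    with b J have m: "0 < m" "m \<le> n" "ivar s' v = n - m" by (auto simp: J_def)
    from step[OF _ m(3) ag] m J have r: "runs n c s' (I (Suc (n - m)))" by (auto simp: J_def)
    have "runs n (Seq c (ISet v (IAdd (IVar v) (IConst 1)))) s' (J (m - 1))"
    proof (rule runs_Seq[OF r], rule runs_ISet)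
      fix s'' assume I: "I (Suc (n - m)) s''" and ag': "agree_off (mod_ivars c) (mod_arrays c) s' s''"
      have "Suc (n - m) = n - (m - 1)" using m by simp
      moreover have "ivar s'' v = n - m" using agree_off_ivar[OF ag'] v m by simp
      moreover have "?agree s' s''" using ag' by (rule agree_off_mono) auto
      with ag have "?agree s s''" by (rule agree_off_trans)
      then have "?agree s (set_ivar v (Suc (n - m)) s'')" by (simp add: agree_off_def)
      ultimately show "J (m - 1) (set_ivar v (ival (IAdd (IVar v) (IConst 1)) s'') s'')"
        using stable[OF I, of "Suc (n - m)"] m by (simp add: J_def)
    qed
    then show "\<exists>m'<m. runs n (Seq c (ISet v (IAdd (IVar v) (IConst 1)))) s' (J m')"
      using m by (intro exI[of _ "m - 1"]) auto
  qed simp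
  then have loop: "runs n ?loop ?s0 P"
  proof (rule runs_frame)
    fix s' assume *: "\<not> bval (ILess (IVar v) (IVar 0)) s' \<and> (\<exists>m'. J m' s')"
    then obtain m where J: "J m s'" by blast
    then have ag: "?agree s s'" by (simp add: J_def)
    then have "ivar s' 0 = n" using n v agree_off_ivar[OF ag, of 0] by simp
    with J * have "m = 0" by (auto simp: J_def)
    with J ag post show "P s'" by (auto simp: J_def)
  qed
  show ?thesis
    unfolding For_def
    by (rule runs_Seq[where R = "\<lambda>s'. s' = ?s0"], rule runs_ISet) (use loop in auto)
qed

section \<open>Nested loops that evaluate multiple sums\<close>

definition adds :: "nat \<Rightarrow> com \<Rightarrow> (state \<Rightarrow> real) \<Rightarrow> bool" where
  "adds n c F \<longleftrightarrow> mod_arrays c = {5} \<and> 0 \<notin> mod_ivars c \<and>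
     (\<forall>s s'. agree_off (mod_ivars c) {5} s s' \<longrightarrow> F s' = F s) \<and>
     (\<forall>s. ivar s 0 = n \<longrightarrow> runs n c s (\<lambda>s'. cell s' 5 0 0 = cell s 5 0 0 + F s))"

definition Add :: "rexp \<Rightarrow> com" where
  "Add e = RSet 5 (IConst 0) (IConst 0) (RAdd (Cell 5 (IConst 0) (IConst 0)) e)"

lemma adds_Add:
  assumes "\<And>s s'. agree_off {} {5} s s' \<Longrightarrow> rval e s' = rval e s"
  shows "adds n (Add e) (rval e)"
  unfolding adds_def Add_def using assms by (auto intro!: runs_RSet)

text \<open>Apart from the counter \<open>v\<close>, nothing that \<open>F\<close> depends on is
  changed by \<open>c\<close> or by earlier iterations. So iteration \<open>k\<close> adds
  \<open>F\<close> of the initial state with \<open>v\<close> set to \<open>k\<close>, and nesting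
  loops nests sums.\<close>

lemma adds_For:
  assumes c: "adds n c F" and v: "v \<noteq> 0" "v \<notin> mod_ivars c"
  shows "adds n (For v c) (\<lambda>s. \<Sum>k<n. F (set_ivar v k s))"
  unfolding adds_def
proof (intro conjI allI impI)
  have indep: "F s' = F s" if "agree_off (mod_ivars c) {5} s s'" for s s'
    using c that by (auto simp: adds_def)
  have arr: "mod_arrays c = {5}" using c by (simp add: adds_def)
  show "mod_arrays (For v c) = {5}" "0 \<notin> mod_ivars (For v c)"
    using c v by (auto simp: adds_def)
  show "(\<Sum>k<n. F (set_ivar v k s')) = (\<Sum>k<n. F (set_ivar v k s))"
    if "agree_off (mod_ivars (For v c)) {5} s s'" for s s'
    using that by (intro sum.cong refl indep) (auto simp: agree_off_def)
  show "runs n (For v c) s (\<lambda>s'. cell s' 5 0 0 = cell s 5 0 0 + (\<Sum>k<n. F (set_ivar v k s)))"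
    if s: "ivar s 0 = n" for s
  proof (rule runs_For[where I = "\<lambda>m s'. cell s' 5 0 0 = cell s 5 0 0 + (\<Sum>k<m. F (set_ivar v k s))"])
    fix k s' assume k: "ivar s' v = k"
      and ag: "agree_off (insert v (mod_ivars c)) (mod_arrays c) s s'"
      and I: "cell s' 5 0 0 = cell s 5 0 0 + (\<Sum>k<k. F (set_ivar v k s))"
    have "ivar s' 0 = n" using agree_off_ivar[OF ag, of 0] s c v by (auto simp: adds_def)
    then have r: "runs n c s' (\<lambda>s''. cell s'' 5 0 0 = cell s' 5 0 0 + F s')"
      using c by (auto simp: adds_def)
    have "F s' = F (set_ivar v k s)"
      using ag k by (intro indep) (auto simp: agree_off_def arr)
    with I show "runs n c s' (\<lambda>s''. cell s'' 5 0 0 = cell s 5 0 0 + (\<Sum>k<Suc k. F (set_ivar v k s)))"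
      by (intro runs_frame[OF r]) simp
  qed (use c v s in \<open>auto simp: adds_def\<close>)
qed

section \<open>The potential function\<close>

text \<open>Matrices and vectors are functions of which only the entries below \<open>n\<close>
  count. The contents of the machine's arrays are such functions and can be plugged in
  directly.\<close>

definition bilin :: "nat \<Rightarrow> (nat \<Rightarrow> nat \<Rightarrow> real) \<Rightarrow> (nat \<Rightarrow> real) \<Rightarrow> (nat \<Rightarrow> real) \<Rightarrow> real" where
  "bilin n M a b = (\<Sum>i<n. \<Sum>j<n. a i * M i j * b j)"

definition symm :: "nat \<Rightarrow> (nat \<Rightarrow> nat \<Rightarrow> real) \<Rightarrow> bool" where
  "symm n M \<longleftrightarrow> (\<forall>i<n. \<forall>j<n. M i j = M j i)"

definition pos_form :: "nat \<Rightarrow> (nat \<Rightarrow> nat \<Rightarrow> real) \<Rightarrow> bool" where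
  "pos_form n M \<longleftrightarrow> symm n M \<and> (\<forall>z. 0 \<le> bilin n M z z)"

lemma bilin_cong:
  "(\<And>i. i < n \<Longrightarrow> a i = a' i) \<Longrightarrow> (\<And>i. i < n \<Longrightarrow> b i = b' i) \<Longrightarrow> bilin n M a b = bilin n M a' b'"
  by (simp add: bilin_def)

lemma bilin_add_left: "bilin n M (\<lambda>i. a i + b i) c = bilin n M a c + bilin n M b c"
  and bilin_add_right: "bilin n M a (\<lambda>i. b i + c i) = bilin n M a b + bilin n M a c"
  and bilin_diff_left: "bilin n M (\<lambda>i. a i - b i) c = bilin n M a c - bilin n M b c"
  and bilin_diff_right: "bilin n M a (\<lambda>i. b i - c i) = bilin n M a b - bilin n M a c"
  and bilin_scale_left: "bilin n M (\<lambda>i. t * a i) b = t * bilin n M a b"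
  and bilin_scale_right: "bilin n M a (\<lambda>i. t * b i) = t * bilin n M a b"
  by (simp_all add: bilin_def algebra_simps sum.distrib sum_subtractf sum_distrib_left)

lemmas bilin_simps = bilin_add_left bilin_add_right bilin_diff_left bilin_diff_right
  bilin_scale_left bilin_scale_right

lemma bilin_commute: "symm n M \<Longrightarrow> bilin n M a b = bilin n M b a"
  unfolding bilin_def symm_def by (subst sum.swap) (auto intro!: sum.cong)

text \<open>The right side minus the left side is \<open>\<theta> * (1 - \<theta>)\<close> times the
  form at \<open>a - b\<close>.\<close>

lemma bilin_convex:
  assumes "pos_form n M" "0 \<le> \<theta>" "\<theta> \<le> 1"
  shows "bilin n M (\<lambda>i. \<theta> * a i + (1 - \<theta>) * b i) (\<lambda>i. \<theta> * a i + (1 - \<theta>) * b i)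
    \<le> \<theta> * bilin n M a a + (1 - \<theta>) * bilin n M b b"
proof -
  have "0 \<le> \<theta> * (1 - \<theta>) * bilin n M (\<lambda>i. a i - b i) (\<lambda>i. a i - b i)"
    using assms by (simp add: pos_form_def)
  also have "\<dots> = \<theta> * bilin n M a a + (1 - \<theta>) * bilin n M b b
    - bilin n M (\<lambda>i. \<theta> * a i + (1 - \<theta>) * b i) (\<lambda>i. \<theta> * a i + (1 - \<theta>) * b i)"
    using bilin_commute[of n M a b] assms(1)
    by (simp add: bilin_simps pos_form_def) (simp add: algebra_simps)
  finally show ?thesis by simp
qed

lemma sum_of_bool [simp]:
  fixes f :: "nat \<Rightarrow> real"
  shows "(\<Sum>k<n. f k * of_bool (k = p)) = (if p < n then f p else 0)"
    "(\<Sum>k<n. f k * of_bool (p = k)) = (if p < n then f p else 0)"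
    "(\<Sum>k<n. of_bool (k = p) * f k) = (if p < n then f p else 0)"
    "(\<Sum>k<n. of_bool (p = k) * f k) = (if p < n then f p else 0)"
  by (simp_all add: of_bool_def if_distrib if_distribR cong: if_cong)

section \<open>Inverses of principal blocks and removal of an index\<close>

definition inverse_on ::
  "nat \<Rightarrow> (nat \<Rightarrow> nat \<Rightarrow> real) \<Rightarrow> nat set \<Rightarrow> (nat \<Rightarrow> nat \<Rightarrow> real) \<Rightarrow> bool" where
  "inverse_on n G A H \<longleftrightarrow> A \<subseteq> {..<n} \<and> symm n H \<and>
     (\<forall>i<n. \<forall>j<n. i \<notin> A \<longrightarrow> H i j = 0) \<and>
     (\<forall>i\<in>A. \<forall>j\<in>A. (\<Sum>k<n. G i k * H k j) = of_bool (i = j))"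

text \<open>For symmetric \<open>H\<close> this is the Schur complement of the entry
  \<open>H j j\<close>, padded by a zero row and column: deleting an index from a matrix takes a
  Schur complement of its inverse.\<close>

definition downdate :: "(nat \<Rightarrow> nat \<Rightarrow> real) \<Rightarrow> nat \<Rightarrow> nat \<Rightarrow> nat \<Rightarrow> real" where
  "downdate H j = (\<lambda>i k. H i k - H i j * H k j / H j j)"

text \<open>For \<open>i\<close> in \<open>A - {j}\<close> the product of row \<open>i\<close> of
  \<open>G\<close> with column \<open>j\<close> of \<open>H\<close> is 0, so the rank one correction
  does not disturb the products that have to be 0 or 1. It cancels row and column
  \<open>j\<close>.\<close>

lemma inverse_on_downdate:
  assumes H: "inverse_on n G A H" and j: "j \<in> A" "H j j \<noteq> 0"
  shows "inverse_on n G (A - {j}) (downdate H j)"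
proof -
  have jn: "j < n" and An: "A \<subseteq> {..<n}" using H j by (auto simp: inverse_on_def)
  have sym: "H i k = H k i" if "i < n" "k < n" for i k
    using H that by (auto simp: inverse_on_def symm_def)
  have zero: "downdate H j i k = 0" if "i < n" "k < n" "i \<notin> A - {j}" for i k
    using H that j sym[of j k] jn by (auto simp: inverse_on_def downdate_def)
  have inv: "(\<Sum>k<n. G i k * downdate H j k l) = of_bool (i = l)"
    if "i \<in> A - {j}" "l \<in> A - {j}" for i l
  proof -
    have "(\<Sum>k<n. G i k * downdate H j k l)
      = (\<Sum>k<n. G i k * H k l) - (\<Sum>k<n. G i k * H k j) * H l j / H j j"
      by (simp add: downdate_def algebra_simps sum_subtractf sum_distrib_left sum_divide_distrib)
    then show ?thesis using H that j by (auto simp: inverse_on_def)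
  qed
  have "symm n (downdate H j)" using sym by (simp add: symm_def downdate_def)
  with zero inv An show ?thesis unfolding inverse_on_def by auto
qed

text \<open>This is Cauchy-Schwarz in the form of \<open>G\<close> for the unit vector
  \<open>e\<close> at \<open>p\<close> and column \<open>h\<close> of \<open>H\<close>: their
  product is 1, and their squares are \<open>G p p\<close> and \<open>H p p\<close>. It is obtained
  from the nonnegative value of the form at \<open>e - G p p * h\<close>.\<close>

lemma inverse_on_diag:
  assumes H: "inverse_on n G A H" and G: "pos_form n G" and p: "p \<in> A" "0 < G p p"
  shows "1 \<le> G p p * H p p"
proof -
  define e where "e i = (of_bool (i = p) :: real)" for i
  define h where "h i = H i p" for i
  have pn: "p < n" using H p by (auto simp: inverse_on_def)
  have Gh: "(\<Sum>k<n. G i k * h k) = of_bool (i = p)" if "i \<in> A" for i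
    using H p that by (simp add: inverse_on_def h_def)
  have zero: "h i = 0" if "i < n" "i \<notin> A" for i using H that pn by (simp add: inverse_on_def h_def)
  have bil: "bilin n G a h = (\<Sum>i<n. a i * (\<Sum>k<n. G i k * h k))" for a
    by (simp add: bilin_def sum_distrib_left mult.assoc)
  have "bilin n G h h = (\<Sum>i<n. h i * of_bool (i = p))"
    unfolding bil
  proof (intro sum.cong refl)
    fix i assume "i \<in> {..<n}"
    then show "h i * (\<Sum>k<n. G i k * h k) = h i * of_bool (i = p)"
      using Gh[of i] zero[of i] by (cases "i \<in> A") simp_all
  qed
  then have hh: "bilin n G h h = H p p" using pn by (simp add: h_def)
  have "bilin n G e h = (\<Sum>k<n. G p k * h k)"
    unfolding bil using pn by (simp add: e_def)
  then have eh: "bilin n G e h = 1" using Gh p by simp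
  have ee: "bilin n G e e = G p p"
    using pn by (simp add: bilin_def e_def)
  have "bilin n G h e = 1" using eh bilin_commute[of n G] G by (simp add: pos_form_def)
  moreover have "0 \<le> bilin n G (\<lambda>i. e i - G p p * h i) (\<lambda>i. e i - G p p * h i)"
    using G by (simp add: pos_form_def)
  ultimately have "0 \<le> G p p * (G p p * H p p - 1)"
    by (simp add: bilin_simps hh eh ee) (simp add: algebra_simps)
  then show ?thesis using p(2) by (simp add: zero_le_mult_iff)
qed

section \<open>The potential under moves and under removals\<close>

definition trace_prod :: "nat \<Rightarrow> (nat \<Rightarrow> nat \<Rightarrow> real) \<Rightarrow> (nat \<Rightarrow> nat \<Rightarrow> real) \<Rightarrow> real" where
  "trace_prod n M H = (\<Sum>i<n. \<Sum>j<n. M i j * H i j)"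

lemma trace_prod_downdate:
  "trace_prod n M (downdate H j) = trace_prod n M H - bilin n M (\<lambda>i. H i j) (\<lambda>i. H i j) / H j j"
  by (simp add: trace_prod_def bilin_def downdate_def algebra_simps sum_subtractf sum_divide_distrib)

text \<open>If \<open>p\<close> is not alive then \<open>H p p = 0\<close>, and the last term vanishes because \<open>x / 0 = 0\<close>.\<close>

definition potential ::
  "nat \<Rightarrow> (nat \<Rightarrow> nat \<Rightarrow> real) \<Rightarrow> (nat \<Rightarrow> nat \<Rightarrow> real) \<Rightarrow> nat \<Rightarrow> (nat \<Rightarrow> real) \<Rightarrow> real" where
  "potential n M H p x = bilin n M x x + 2 * trace_prod n M H
     - (x p)\<^sup>2 * bilin n M (\<lambda>i. H i p) (\<lambda>i. H i p) / (H p p)\<^sup>2"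

text \<open>The subtracted term is nonnegative. This makes it free to start with a new
  pivot.\<close>

lemma potential_le:
  "pos_form n M \<Longrightarrow> potential n M H p x \<le> bilin n M x x + 2 * trace_prod n M H"
  by (simp add: potential_def pos_form_def)

text \<open>Entry \<open>p\<close> of the direction \<open>h\<close> is \<open>H p p\<close>, so the
  last term of the potential changes by the same multiple of \<open>\<delta>\<^sup>2\<close> as the
  first, and the two cancel. What is left is \<open>2 * \<delta> / H p p\<close> times the left side
  of \<open>descent\<close>.\<close>

lemma potential_move:
  assumes M: "pos_form n M" and pos: "0 < H p p" and "0 \<le> \<delta>"
    and descent: "\<sigma> * bilin n M (\<lambda>i. H p p * x i - x p * H i p) (\<lambda>i. H i p) \<le> 0"
  shows "potential n M H p (\<lambda>i. x i + \<delta> * (\<sigma> * H i p)) \<le> potential n M H p x"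
proof -
  define h where "h = (\<lambda>i. H i p)"
  define \<alpha> where "\<alpha> = H p p"
  have \<alpha>: "\<alpha> > 0" "h p = \<alpha>" using pos by (simp_all add: \<alpha>_def h_def)
  have comm: "bilin n M h x = bilin n M x h" using M bilin_commute by (simp add: pos_form_def)
  have g: "bilin n M (\<lambda>i. H p p * x i - x p * H i p) (\<lambda>i. H i p) =
      \<alpha> * bilin n M x h - x p * bilin n M h h"
    by (simp add: \<alpha>_def h_def bilin_simps)
  have "potential n M H p (\<lambda>i. x i + \<delta> * (\<sigma> * h i)) - potential n M H p x
     = 2 * \<delta> / \<alpha> * (\<sigma> * (\<alpha> * bilin n M x h - x p * bilin n M h h))"
    unfolding potential_def
    using \<alpha> by (simp add: bilin_simps comm flip: h_def \<alpha>_def)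
      (simp add: field_simps power2_eq_square)
  also have "\<dots> \<le> 0"
    using descent \<open>0 \<le> \<delta>\<close> \<alpha> unfolding g by (intro mult_nonneg_nonpos[of "2 * \<delta> / \<alpha>"]) auto
  finally show ?thesis by (simp add: h_def)
qed

lemma downdate_diag_pivot: "H p p \<noteq> 0 \<Longrightarrow> downdate H p p p = 0"
  by (simp add: downdate_def)

text \<open>With \<open>b\<close> the form at column \<open>p\<close>, the lost last term is b / (H
  p p)^2, and twice the trace term falls by 2 b / H p p. The bound 1/2 on \<open>H p p\<close> is
  exactly what makes the fall large enough.\<close>

lemma potential_drop_pivot:
  assumes M: "pos_form n M" and p: "1/2 \<le> H p p" "\<bar>x p\<bar> = 1"
  shows "potential n M (downdate H p) p x \<le> potential n M H p x"
proof -
  define b where "b = bilin n M (\<lambda>i. H i p) (\<lambda>i. H i p)"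
  have "0 \<le> b" using M by (simp add: b_def pos_form_def)
  moreover have "1 / (H p p)\<^sup>2 \<le> 2 / H p p" using p(1) by (simp add: field_simps power2_eq_square)
  ultimately have "b * (1 / (H p p)\<^sup>2) \<le> b * (2 / H p p)" by (rule mult_left_mono[rotated])
  then have "b / (H p p)\<^sup>2 \<le> 2 * b / H p p" by (simp add: mult.commute)
  moreover have "(x p)\<^sup>2 = 1" using p(2) by (metis one_power2 power2_abs)
  ultimately show ?thesis
    using p(1) by (simp add: potential_def trace_prod_downdate downdate_diag_pivot flip: b_def)
qed

text \<open>Jensen's inequality: the old direction \<open>h / H p p\<close>, where \<open>h\<close> is column \<open>p\<close> of \<open>H\<close>, is a
  convex combination of the new one and of a multiple of the dropped column.\<close>

lemma potential_drop_other:
  assumes M: "pos_form n M" and H: "symm n H" "p < n" "j < n"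
    and pos: "1/2 \<le> H p p" "0 < H j j" "0 < downdate H j p p" and x: "\<bar>x p\<bar> \<le> 1"
  shows "potential n M (downdate H j) p x \<le> potential n M H p x"
proof -
  define \<alpha> where "\<alpha> = H p p"
  define \<beta> where "\<beta> = H j j"
  define \<gamma> where "\<gamma> = H p j"
  define b where "b i = H i j" for i
  define \<alpha>' where "\<alpha>' = downdate H j p p"
  define u where "u i = H i p / \<alpha>" for i
  define u' where "u' i = downdate H j i p / \<alpha>'" for i
  have \<alpha>': "\<alpha>' = \<alpha> - \<gamma>\<^sup>2 / \<beta>" by (simp add: \<alpha>'_def \<alpha>_def \<beta>_def \<gamma>_def downdate_def power2_eq_square)
  have pos': "0 < \<alpha>" "0 < \<beta>" "0 < \<alpha>'" using pos by (simp_all add: \<alpha>_def \<beta>_def \<alpha>'_def)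
  have bb: "0 \<le> bilin n M b b" "0 \<le> bilin n M u' u'" using M by (simp_all add: pos_form_def)
  have dd: "bilin n M (\<lambda>i. c i / t) (\<lambda>i. c i / t) = bilin n M c c / t\<^sup>2" for c t
    using bilin_scale_left[of n M "1 / t" c] bilin_scale_right[of n M _ "1 / t" c]
    by (simp add: power2_eq_square)
  have u: "bilin n M u u \<le> bilin n M u' u' + 2 * (bilin n M b b / \<beta>)"
  proof (cases "\<gamma> = 0")
    \<comment> \<open>The dropped column then does not affect column \<open>p\<close>, whereas the
      combination used in the other case divides by \<open>\<gamma>\<close>.\<close>
    case True
    then have "bilin n M u u = bilin n M u' u'"
      by (intro bilin_cong) (auto simp: u_def u'_def \<alpha>' \<gamma>_def downdate_def)
    then show ?thesis using bb pos' by simp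
  next
    case False
    \<comment> \<open>This weight turns the denominator of \<open>u'\<close> into that of
      \<open>u\<close>, so that the remaining difference is a multiple of the dropped column
      \<open>b\<close>.\<close>
    define \<theta> where "\<theta> = \<alpha>' / \<alpha>"
    have \<theta>': "1 - \<theta> = \<gamma>\<^sup>2 / (\<alpha> * \<beta>)" using pos' by (simp add: \<theta>_def \<alpha>' field_simps)
    moreover have "0 \<le> \<gamma>\<^sup>2 / (\<alpha> * \<beta>)" using pos' by simp
    ultimately have "\<theta> \<le> 1" by linarith
    then have \<theta>: "0 \<le> \<theta>" "\<theta> \<le> 1" using pos' by (simp_all add: \<theta>_def)
    have "u i = \<theta> * u' i + (1 - \<theta>) * (b i / \<gamma>)" if "i < n" for i
    proof -
      have "\<theta> * u' i = (H i p - b i * \<gamma> / \<beta>) / \<alpha>"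
        using pos' by (simp add: \<theta>_def u'_def downdate_def b_def \<gamma>_def \<beta>_def)
      moreover have "(1 - \<theta>) * (b i / \<gamma>) = b i * \<gamma> / \<beta> / \<alpha>"
        unfolding \<theta>' using False pos' by (simp add: field_simps power2_eq_square)
      ultimately show ?thesis by (simp add: u_def diff_divide_distrib)
    qed
    then have "bilin n M u u =
        bilin n M (\<lambda>i. \<theta> * u' i + (1 - \<theta>) * (b i / \<gamma>)) (\<lambda>i. \<theta> * u' i + (1 - \<theta>) * (b i / \<gamma>))"
      by (intro bilin_cong) auto
    also have "\<dots> \<le> \<theta> * bilin n M u' u' + (1 - \<theta>) * bilin n M (\<lambda>i. b i / \<gamma>) (\<lambda>i. b i / \<gamma>)"
      by (rule bilin_convex[OF M \<theta>])
    \<comment> \<open>The factor \<open>\<gamma>\<^sup>2\<close> in \<open>1 - \<theta>\<close>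
      cancels the scaling of \<open>b\<close>, and the lower bound on \<open>H p p\<close> limits
      the remaining \<open>1 / \<alpha>\<close> to 2.\<close>
    also have "(1 - \<theta>) * bilin n M (\<lambda>i. b i / \<gamma>) (\<lambda>i. b i / \<gamma>) = 1 / \<alpha> * (bilin n M b b / \<beta>)"
      unfolding dd \<theta>' using False by (simp add: field_simps)
    also have "1 / \<alpha> * (bilin n M b b / \<beta>) \<le> 2 * (bilin n M b b / \<beta>)"
      using pos(1) bb pos' by (intro mult_right_mono) (auto simp: \<alpha>_def field_simps)
    also have "\<theta> * bilin n M u' u' \<le> bilin n M u' u'"
      using \<theta> bb by (simp add: mult_left_le_one_le)
    finally show ?thesis by simp
  qed
  define s where "s = (x p)\<^sup>2"
  have s: "0 \<le> s" "s \<le> 1" using x by (simp_all add: s_def abs_square_le_1)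
  \<comment> \<open>Because \<open>s\<close> is at most 1, the fall of twice the trace term covers
    the change for every admissible value of \<open>x p\<close>.\<close>
  have "s * bilin n M u u \<le> s * bilin n M u' u' + s * (2 * (bilin n M b b / \<beta>))"
    using mult_left_mono[OF u s(1)] by (simp add: distrib_left)
  also have "s * (2 * (bilin n M b b / \<beta>)) \<le> 2 * (bilin n M b b / \<beta>)"
    using s bb pos' by (intro mult_left_le_one_le) auto
  finally have "s * bilin n M u u \<le> s * bilin n M u' u' + 2 * (bilin n M b b / \<beta>)" by simp
  then show ?thesis
    unfolding u_def u'_def dd potential_def trace_prod_downdate s_def b_def \<alpha>_def \<alpha>'_def \<beta>_def by simp
qed

section \<open>The initial value of the potential\<close>

text \<open>The parameter \<open>k\<close> is the number of rows of \<open>Q\<close> taken into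
  account: \<open>gram 0 Q\<close> is the identity, \<open>gram n Q\<close> is I + Q^T Q, and each
  row is a rank one update.\<close>

definition gram :: "nat \<Rightarrow> (nat \<Rightarrow> nat \<Rightarrow> real) \<Rightarrow> nat \<Rightarrow> nat \<Rightarrow> real" where
  "gram k Q i j = of_bool (i = j) + (\<Sum>m<k. Q m i * Q m j)"

text \<open>This is Q^T B Q.\<close>

definition pullback ::
  "nat \<Rightarrow> (nat \<Rightarrow> nat \<Rightarrow> real) \<Rightarrow> (nat \<Rightarrow> nat \<Rightarrow> real) \<Rightarrow> nat \<Rightarrow> nat \<Rightarrow> real" where
  "pullback n Q B i j = (\<Sum>k<n. \<Sum>l<n. Q k i * B k l * Q l j)"

lemma sum_swap_pairs:
  "(\<Sum>i\<in>A. \<Sum>j\<in>B. \<Sum>k\<in>C. \<Sum>l\<in>D. f i j k l) = (\<Sum>k\<in>C. \<Sum>l\<in>D. \<Sum>i\<in>A. \<Sum>j\<in>B. f i j k l)"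
proof -
  have "(\<Sum>i\<in>A. \<Sum>j\<in>B. \<Sum>k\<in>C. \<Sum>l\<in>D. f i j k l) = (\<Sum>i\<in>A. \<Sum>k\<in>C. \<Sum>j\<in>B. \<Sum>l\<in>D. f i j k l)"
    by (intro sum.cong refl sum.swap)
  also have "\<dots> = (\<Sum>k\<in>C. \<Sum>i\<in>A. \<Sum>l\<in>D. \<Sum>j\<in>B. f i j k l)"
    by (subst sum.swap) (intro sum.cong refl sum.swap)
  also have "\<dots> = (\<Sum>k\<in>C. \<Sum>l\<in>D. \<Sum>i\<in>A. \<Sum>j\<in>B. f i j k l)"
    by (intro sum.cong refl sum.swap)
  finally show ?thesis .
qed

lemma bilin_pullback:
  "bilin n (pullback n Q B) a b =
     bilin n B (\<lambda>k. \<Sum>i<n. Q k i * a i) (\<lambda>l. \<Sum>j<n. Q l j * b j)"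
proof -
  have "bilin n (pullback n Q B) a b =
      (\<Sum>i<n. \<Sum>j<n. \<Sum>k<n. \<Sum>l<n. Q k i * a i * B k l * (Q l j * b j))"
    by (simp add: bilin_def pullback_def sum_distrib_left sum_distrib_right mult_ac)
  also have "\<dots> = (\<Sum>k<n. \<Sum>l<n. \<Sum>i<n. \<Sum>j<n. Q k i * a i * B k l * (Q l j * b j))"
    by (rule sum_swap_pairs)
  also have "\<dots> = bilin n B (\<lambda>k. \<Sum>i<n. Q k i * a i) (\<lambda>l. \<Sum>j<n. Q l j * b j)"
    by (simp only: bilin_def sum_distrib_right) (simp only: sum_distrib_left)
  finally show ?thesis .
qed

lemma pos_form_pullback: "pos_form n B \<Longrightarrow> pos_form n (pullback n Q B)"
proof -
  assume B: "pos_form n B"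
  have "pullback n Q B i j = pullback n Q B j i" for i j
  proof -
    have "pullback n Q B i j = (\<Sum>l<n. \<Sum>k<n. Q k i * B k l * Q l j)"
      unfolding pullback_def by (rule sum.swap)
    also have "\<dots> = pullback n Q B j i"
      unfolding pullback_def using B
      by (intro sum.cong refl) (auto simp: pos_form_def symm_def mult_ac)
    finally show ?thesis .
  qed
  with B show ?thesis by (simp add: pos_form_def bilin_pullback symm_def)
qed

text \<open>The form at \<open>z\<close> is the sum of the squares of the entries of
  \<open>z\<close> and of its products with the first \<open>k\<close> rows of
  \<open>Q\<close>.\<close>

lemma pos_form_gram: "pos_form n (gram k Q)"
proof -
  have "bilin n (gram k Q) z z = (\<Sum>i<n. (z i)\<^sup>2) + (\<Sum>m<k. (\<Sum>i<n. z i * Q m i)\<^sup>2)" for z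
  proof -
    have "bilin n (gram k Q) z z =
        (\<Sum>i<n. (\<Sum>j<n. z i * z j * of_bool (i = j)) + (\<Sum>j<n. \<Sum>m<k. (z i * Q m i) * (z j * Q m j)))"
      by (simp add: bilin_def gram_def algebra_simps sum.distrib sum_distrib_left del: sum_of_bool)
    also have "\<dots> = (\<Sum>i<n. (z i)\<^sup>2) + (\<Sum>i<n. \<Sum>j<n. \<Sum>m<k. (z i * Q m i) * (z j * Q m j))"
      by (simp add: sum.distrib power2_eq_square)
    also have "(\<Sum>i<n. \<Sum>j<n. \<Sum>m<k. (z i * Q m i) * (z j * Q m j)) =
        (\<Sum>i<n. \<Sum>m<k. \<Sum>j<n. (z i * Q m i) * (z j * Q m j))"
      by (intro sum.cong refl sum.swap)
    also have "\<dots> = (\<Sum>m<k. \<Sum>i<n. \<Sum>j<n. (z i * Q m i) * (z j * Q m j))"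
      by (rule sum.swap)
    finally show ?thesis by (simp add: power2_eq_square sum_product)
  qed
  then show ?thesis by (auto simp: pos_form_def symm_def gram_def mult.commute intro!: add_nonneg_nonneg sum_nonneg)
qed

lemma inverse_on_gram_0:
  "(\<And>i j. i < n \<Longrightarrow> j < n \<Longrightarrow> H i j = of_bool (i = j)) \<Longrightarrow> inverse_on n (gram 0 Q) {..<n} H"
  by (auto simp: inverse_on_def symm_def gram_def)

text \<open>This is the Sherman-Morrison formula.\<close>

lemma inverse_on_gram_Suc:
  assumes H: "inverse_on n (gram m Q) {..<n} H"
    and v: "\<And>i. i < n \<Longrightarrow> v i = (\<Sum>j<n. H i j * Q m j)"
    and d: "d = 1 + (\<Sum>j<n. Q m j * v j)"
    and H': "\<And>i j. i < n \<Longrightarrow> j < n \<Longrightarrow> H' i j = H i j - v i * v j / d"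
  shows "inverse_on n (gram (Suc m) Q) {..<n} H'"
proof -
  have sym: "H i j = H j i" if "i < n" "j < n" for i j
    using H that by (simp add: inverse_on_def symm_def)
  have inv: "(\<Sum>k<n. gram m Q i k * H k j) = of_bool (i = j)" if "i < n" "j < n" for i j
    using H that by (simp add: inverse_on_def)
  have Gv: "(\<Sum>k<n. gram m Q i k * v k) = Q m i" if "i < n" for i
  proof -
    have "(\<Sum>k<n. gram m Q i k * v k) = (\<Sum>k<n. \<Sum>j<n. gram m Q i k * H k j * Q m j)"
      by (simp add: v sum_distrib_left mult.assoc)
    also have "\<dots> = (\<Sum>j<n. (\<Sum>k<n. gram m Q i k * H k j) * Q m j)"
      by (subst sum.swap) (simp add: sum_distrib_right)
    also have "\<dots> = (\<Sum>j<n. of_bool (i = j) * Q m j)" using inv that by (intro sum.cong) auto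
    finally show ?thesis using that by simp
  qed
  \<comment> \<open>The sum in \<open>d\<close> is the value of a positive form at \<open>v\<close>;
    hence \<open>d\<close> is at least 1 and may be divided by.\<close>
  have "(\<Sum>i<n. v i * Q m i) = bilin n (gram m Q) v v"
    by (simp add: bilin_def mult.assoc Gv flip: sum_distrib_left)
  then have "0 \<le> (\<Sum>i<n. Q m i * v i)"
    using pos_form_gram[of n m Q] by (simp add: pos_form_def mult.commute)
  then have d0: "d \<noteq> 0" using d by simp
  have Qv: "(\<Sum>k<n. Q m k * H k j) = v j" if "j < n" for j
    using that sym by (simp add: v mult.commute)
  have Suc: "gram (Suc m) Q i k = gram m Q i k + Q m i * Q m k" for i k by (simp add: gram_def)
  have "(\<Sum>k<n. gram (Suc m) Q i k * H' k j) = of_bool (i = j)" if ij: "i < n" "j < n" for i j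
  proof -
    have "(\<Sum>k<n. gram (Suc m) Q i k * H' k j) = (\<Sum>k<n. gram m Q i k * H k j
        - gram m Q i k * v k * (v j / d) + Q m i * (Q m k * H k j - Q m k * v k * (v j / d)))"
      using ij by (intro sum.cong refl) (simp add: Suc H' algebra_simps)
    also have "\<dots> =
      (\<Sum>k<n. gram m Q i k * H k j) - (\<Sum>k<n. gram m Q i k * v k) * (v j / d)
      + Q m i * ((\<Sum>k<n. Q m k * H k j) - (\<Sum>k<n. Q m k * v k) * (v j / d))"
      by (simp add: sum.distrib sum_subtractf flip: sum_distrib_left sum_distrib_right times_divide_eq_right)
    also have "\<dots> = of_bool (i = j) - Q m i * v j / d + Q m i * (v j - (d - 1) * v j / d)"
      using ij by (simp add: inv Gv Qv d)
    also have "\<dots> = of_bool (i = j)" using d0 by (simp add: field_simps)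
    finally show ?thesis .
  qed
  moreover have "symm n H'" using sym by (simp add: symm_def H' mult.commute)
  ultimately show ?thesis by (simp add: inverse_on_def)
qed

text \<open>The matrix \<open>N = I - Q H Q\<^sup>T\<close> equals \<open>N\<^sup>T N + Y\<^sup>T Y\<close> with \<open>Y = H Q\<^sup>T = Q\<^sup>T N\<close>, so its trace
  product with \<open>B\<close> is nonnegative.\<close>

lemma trace_prod_pullback_le:
  assumes H: "inverse_on n (gram n Q) {..<n} H" and B: "pos_form n B"
  shows "trace_prod n (pullback n Q B) H \<le> (\<Sum>i<n. B i i)"
proof -
  have sym: "H i j = H j i" if "i < n" "j < n" for i j
    using H that by (simp add: inverse_on_def symm_def)
  have inv: "(\<Sum>k<n. gram n Q i k * H k j) = of_bool (i = j)" if "i < n" "j < n" for i j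
    using H that by (simp add: inverse_on_def)
  define Y where "Y i l = (\<Sum>j<n. H i j * Q l j)" for i l
  define N where "N k l = of_bool (k = l) - (\<Sum>i<n. Q k i * Y i l)" for k l
  have QY: "(\<Sum>i<n. Q k i * Y i l) = (\<Sum>i<n. \<Sum>j<n. Q k i * H i j * Q l j)" for k l
    by (simp add: Y_def sum_distrib_left mult.assoc)
  have N_sym: "N k l = N l k" for k l
    unfolding N_def QY by (subst sum.swap) (auto simp: sym mult_ac intro!: sum.cong)
  have GY: "(\<Sum>k<n. gram n Q i k * Y k l) = Q l i" if "i < n" for i l
  proof -
    have "(\<Sum>k<n. gram n Q i k * Y k l) = (\<Sum>k<n. \<Sum>j<n. gram n Q i k * H k j * Q l j)"
      by (simp add: Y_def sum_distrib_left mult.assoc)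
    also have "\<dots> = (\<Sum>j<n. (\<Sum>k<n. gram n Q i k * H k j) * Q l j)"
      by (subst sum.swap) (simp add: sum_distrib_right)
    also have "\<dots> = (\<Sum>j<n. of_bool (i = j) * Q l j)" using inv that by (intro sum.cong) auto
    finally show ?thesis using that by simp
  qed
  \<comment> \<open>From (I + Q^T Q) Y = Q^T follows Y = Q^T (I - Q Y) = Q^T N.\<close>
  have Y: "Y i l = (\<Sum>k<n. Q k i * N k l)" if "i < n" "l < n" for i l
  proof -
    have "Q l i = (\<Sum>k<n. of_bool (i = k) * Y k l) + (\<Sum>k<n. \<Sum>m<n. Q m i * Q m k * Y k l)"
      using GY[of i l] that by (simp add: gram_def algebra_simps sum.distrib sum_distrib_left)
    also have "(\<Sum>k<n. \<Sum>m<n. Q m i * Q m k * Y k l) = (\<Sum>m<n. Q m i * (\<Sum>k<n. Q m k * Y k l))"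
      by (subst sum.swap) (simp add: sum_distrib_left mult.assoc)
    finally show ?thesis
      using that by (simp add: N_def algebra_simps sum_subtractf)
  qed
  \<comment> \<open>Y^T Y = N^T Q Y = N^T (I - N), and N is symmetric.\<close>
  have N: "N k l = (\<Sum>m<n. N m k * N m l) + (\<Sum>i<n. Y i k * Y i l)" if "k < n" "l < n" for k l
  proof -
    have "(\<Sum>i<n. Y i k * Y i l) = (\<Sum>i<n. \<Sum>m<n. Q m i * N m k * Y i l)"
      using that by (simp add: Y[of _ k] sum_distrib_right)
    also have "\<dots> = (\<Sum>m<n. N m k * (\<Sum>i<n. Q m i * Y i l))"
      by (subst sum.swap) (simp add: sum_distrib_left mult_ac)
    also have "\<dots> = (\<Sum>m<n. N m k * (of_bool (m = l) - N m l))"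
      by (simp add: N_def)
    also have "\<dots> = N l k - (\<Sum>m<n. N m k * N m l)"
      using that by (simp add: right_diff_distrib sum_subtractf)
    finally show ?thesis using N_sym[of k l] by simp
  qed
  \<comment> \<open>The trace product of B with W^T W is the sum of the values of the form of B at
    the rows of W.\<close>
  have sq: "(\<Sum>k<n. \<Sum>l<n. B k l * (\<Sum>m<n. W m k * W m l)) = (\<Sum>m<n. bilin n B (W m) (W m))"
    for W :: "nat \<Rightarrow> nat \<Rightarrow> real"
  proof -
    have "(\<Sum>k<n. \<Sum>l<n. B k l * (\<Sum>m<n. W m k * W m l)) =
        (\<Sum>k<n. \<Sum>l<n. \<Sum>m<n. W m k * B k l * W m l)"
      by (simp add: sum_distrib_left mult_ac)
    also have "\<dots> = (\<Sum>k<n. \<Sum>m<n. \<Sum>l<n. W m k * B k l * W m l)"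
      by (intro sum.cong refl sum.swap)
    also have "\<dots> = (\<Sum>m<n. bilin n B (W m) (W m))"
      unfolding bilin_def by (rule sum.swap)
    finally show ?thesis .
  qed
  have "B k l * N k l = B k l * (\<Sum>m<n. N m k * N m l) + B k l * (\<Sum>i<n. Y i k * Y i l)"
    if "k < n" "l < n" for k l
    by (subst N[OF that]) (rule distrib_left)
  then have "(\<Sum>k<n. \<Sum>l<n. B k l * N k l) =
      (\<Sum>k<n. \<Sum>l<n. B k l * (\<Sum>m<n. N m k * N m l)) + (\<Sum>k<n. \<Sum>l<n. B k l * (\<Sum>i<n. Y i k * Y i l))"
    by (simp add: sum.distrib)
  also have "\<dots> \<ge> 0"
    unfolding sq using B by (intro add_nonneg_nonneg sum_nonneg) (auto simp: pos_form_def)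
  finally have "0 \<le> (\<Sum>k<n. \<Sum>l<n. B k l * N k l)" .
  also have "\<dots> = (\<Sum>k<n. B k k) - (\<Sum>k<n. \<Sum>l<n. B k l * (\<Sum>i<n. Q k i * Y i l))"
    by (simp add: N_def right_diff_distrib sum_subtractf)
  \<comment> \<open>Cyclicity of the trace: Tr (B Q H Q^T) = Tr (Q^T B Q H).\<close>
  also have "(\<Sum>k<n. \<Sum>l<n. B k l * (\<Sum>i<n. Q k i * Y i l)) = trace_prod n (pullback n Q B) H"
  proof -
    have "trace_prod n (pullback n Q B) H =
        (\<Sum>i<n. \<Sum>j<n. \<Sum>k<n. \<Sum>l<n. B k l * (Q k i * H i j * Q l j))"
      by (simp add: trace_prod_def pullback_def sum_distrib_left mult_ac)
    also have "\<dots> = (\<Sum>k<n. \<Sum>l<n. \<Sum>i<n. \<Sum>j<n. B k l * (Q k i * H i j * Q l j))"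
      by (rule sum_swap_pairs)
    finally show ?thesis by (simp add: QY sum_distrib_left)
  qed
  finally show ?thesis by simp
qed

section \<open>The program\<close>

text \<open>Array 3 holds \<open>H\<close>, column 0 of array 4 a work vector, \<open>Cell 5 0 0\<close> an accumulator and
  \<open>Cell 6 0 0\<close> the step length. Index variable 1 is the row being added or the pivot, and index
  variable 6 the coordinate to be dropped.\<close>

abbreviation "Acc \<equiv> Cell 5 (IConst 0) (IConst 0)"
abbreviation "Step \<equiv> Cell 6 (IConst 0) (IConst 0)"
abbreviation "X i \<equiv> Cell 2 i (IConst 0)"
abbreviation "W i \<equiv> Cell 4 i (IConst 0)"
abbreviation "SetAcc \<equiv> RSet 5 (IConst 0) (IConst 0)"
abbreviation "SetStep \<equiv> RSet 6 (IConst 0) (IConst 0)"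
abbreviation "SetX i \<equiv> RSet 2 i (IConst 0)"
abbreviation "SetW i \<equiv> RSet 4 i (IConst 0)"

text \<open>One routine serves both the Sherman-Morrison updates and the removal of a coordinate.
  The vector and the divisor are kept outside array 3, which is overwritten during the
  update.\<close>

definition RankOne :: com where
  "RankOne = For 2 (For 3 (RSet 3 (IVar 2) (IVar 3)
     (RSub (Cell 3 (IVar 2) (IVar 3)) (RDiv (RMul (W (IVar 2)) (W (IVar 3))) Acc))))"

definition Identity :: com where
  "Identity = For 2 (RSet 3 (IVar 2) (IVar 2) (RConst 1))"

text \<open>The second accumulation starts from 1, so \<open>Acc\<close> ends as the denominator of
  the Sherman-Morrison formula.\<close>

definition AddRow :: com where
  "AddRow =
     Seq (For 2 (Seq (SetAcc (RConst 0))
       (Seq (For 3 (Add (RMul (Cell 3 (IVar 2) (IVar 3)) (Cell 1 (IVar 1) (IVar 3)))))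
         (SetW (IVar 2) Acc))))
     (Seq (SetAcc (RConst 1))
     (Seq (For 3 (Add (RMul (Cell 1 (IVar 1) (IVar 3)) (W (IVar 3)))))
       RankOne))"

text \<open>Half the derivative of the potential along column \<open>p\<close> of \<open>H\<close>,
  times \<open>H p p\<close>; only its sign matters. The matrix Q^T B Q is not stored but multiplied
  out in the fourfold sum.\<close>

definition Slope :: com where
  "Slope = Seq (SetAcc (RConst 0)) (For 2 (For 3 (For 4 (For 5 (Add
     (RMul (RSub (RMul (Cell 3 (IVar 1) (IVar 1)) (X (IVar 2)))
                 (RMul (X (IVar 1)) (Cell 3 (IVar 2) (IVar 1))))
       (RMul (RMul (RMul (Cell 1 (IVar 4) (IVar 2)) (Cell 0 (IVar 4) (IVar 5)))
                   (Cell 1 (IVar 5) (IVar 3)))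
             (Cell 3 (IVar 3) (IVar 1)))))))))"

text \<open>For \<open>\<sigma>\<close> equal to 1 or -1, this step length takes the pivot
  coordinate exactly to \<open>\<sigma>\<close>.\<close>

definition Direct :: "int \<Rightarrow> com" where
  "Direct \<sigma> = Seq (For 2 (SetW (IVar 2) (RMul (RConst \<sigma>) (Cell 3 (IVar 2) (IVar 1)))))
     (SetStep (RDiv (RSub (RConst 1) (RMul (RConst \<sigma>) (X (IVar 1)))) (Cell 3 (IVar 1) (IVar 1))))"

text \<open>The pivot is the first candidate, as \<open>Direct\<close> moves it to the boundary. A
  coordinate that would leave the cube shortens the step and becomes the candidate.\<close>

definition Scan :: com where
  "Scan = Seq (ISet 6 (IVar 1)) (For 2
     (Cond (RLess (RConst 1) (RAdd (X (IVar 2)) (RMul Step (W (IVar 2)))))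
       (Seq (SetStep (RDiv (RSub (RConst 1) (X (IVar 2))) (W (IVar 2)))) (ISet 6 (IVar 2)))
     (Cond (RLess (RAdd (X (IVar 2)) (RMul Step (W (IVar 2)))) (RConst (-1)))
       (Seq (SetStep (RDiv (RSub (RConst (-1)) (X (IVar 2))) (W (IVar 2)))) (ISet 6 (IVar 2)))
     Skip)))"

definition Move :: com where
  "Move = For 2 (SetX (IVar 2) (RAdd (X (IVar 2)) (RMul Step (W (IVar 2)))))"

definition Drop :: com where
  "Drop = Seq (For 2 (SetW (IVar 2) (Cell 3 (IVar 2) (IVar 6))))
     (Seq (SetAcc (Cell 3 (IVar 6) (IVar 6))) RankOne)"

definition Walk :: com where
  "Walk = Seq Slope (Seq (Cond (RLess (RConst 0) Acc) (Direct (-1)) (Direct 1))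
     (Seq Scan (Seq Move Drop)))"

text \<open>The alive set is not stored: the diagonal entry of array 3 at the pivot is at least 1/2
  if the pivot is alive and 0 otherwise, so the loop test recognises it.\<close>

definition Program :: com where
  "Program = Seq Identity (Seq (For 1 AddRow)
     (For 1 (Loop (RLess (RConst 0) (Cell 3 (IVar 1) (IVar 1))) Walk)))"

lemma mod_Add [simp]: "mod_ivars (Add e) = {}" "mod_arrays (Add e) = {5}"
  by (simp_all add: Add_def)

lemma mod_program [simp]:
  "mod_ivars RankOne = {2, 3}" "mod_arrays RankOne = {3}"
  "mod_ivars Identity = {2}" "mod_arrays Identity = {3}"
  "mod_ivars AddRow = {2, 3}" "mod_arrays AddRow = {3, 4, 5}"
  "mod_ivars Slope = {2, 3, 4, 5}" "mod_arrays Slope = {5}"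
  "mod_ivars (Direct \<sigma>) = {2}" "mod_arrays (Direct \<sigma>) = {4, 6}"
  "mod_ivars Scan = {2, 6}" "mod_arrays Scan = {6}"
  "mod_ivars Move = {2}" "mod_arrays Move = {2}"
  "mod_ivars Drop = {2, 3}" "mod_arrays Drop = {3, 4, 5}"
  "mod_ivars Walk = {2, 3, 4, 5, 6}" "mod_arrays Walk = {2, 3, 4, 5, 6}"
  by (auto simp: RankOne_def Identity_def AddRow_def Slope_def Direct_def Scan_def Move_def
      Drop_def Walk_def)

section \<open>Verification of the subroutines\<close>

lemma runs_RSet_Seq:
  "runs n d (set_cell a (ival i s) (ival j s) (rval e s) s) P \<Longrightarrow> runs n (Seq (RSet a i j e) d) s P"
  by (rule runs_Seq[where R = "\<lambda>s'. s' = set_cell a (ival i s) (ival j s) (rval e s) s"])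
    (auto intro: runs_RSet)

lemma runs_adds:
  assumes "adds n c F" "ivar s 0 = n" "F s = r"
  shows "runs n c s (\<lambda>s'. cell s' 5 0 0 = cell s 5 0 0 + r)"
  using assms by (auto simp: adds_def)

lemma runs_RankOne:
  assumes "ivar s 0 = n"
  shows "runs n RankOne s (\<lambda>s'. \<forall>i<n. \<forall>j<n.
    cell s' 3 i j = cell s 3 i j - cell s 4 i 0 * cell s 4 j 0 / cell s 5 0 0)"
proof -
  let ?upd = "RSet 3 (IVar 2) (IVar 3)
      (RSub (Cell 3 (IVar 2) (IVar 3)) (RDiv (RMul (W (IVar 2)) (W (IVar 3))) Acc))"
  define new where "new i j = cell s 3 i j - cell s 4 i 0 * cell s 4 j 0 / cell s 5 0 0" for i j
  have "runs n RankOne s (\<lambda>s'. \<forall>i<n. \<forall>j<n. cell s' 3 i j = new i j)"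
    unfolding RankOne_def
  proof (rule runs_For[where I = "\<lambda>k s'. \<forall>i<n. \<forall>j<n. cell s' 3 i j = (if i < k then new i j else cell s 3 i j)"])
    fix k s'
    assume k: "k < n" "ivar s' 2 = k"
      and ag: "agree_off (insert 2 (mod_ivars (For 3 ?upd))) (mod_arrays (For 3 ?upd)) s s'"
      and I: "\<forall>i<n. \<forall>j<n. cell s' 3 i j = (if i < k then new i j else cell s 3 i j)"
    show "runs n (For 3 ?upd) s'
         (\<lambda>s'. \<forall>i<n. \<forall>j<n. cell s' 3 i j = (if i < Suc k then new i j else cell s 3 i j))"
    proof (rule runs_For[where I = "\<lambda>l s'. \<forall>i<n. \<forall>j<n. cell s' 3 i j =
        (if i < k \<or> i = k \<and> j < l then new i j else cell s 3 i j)"])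
      fix l s''
      assume "l < n" "ivar s'' 3 = l"
        "agree_off (insert 3 (mod_ivars ?upd)) (mod_arrays ?upd) s' s''"
        "\<forall>i<n. \<forall>j<n. cell s'' 3 i j = (if i < k \<or> i = k \<and> j < l then new i j else cell s 3 i j)"
      with ag k show "runs n ?upd s''
         (\<lambda>s''. \<forall>i<n. \<forall>j<n. cell s'' 3 i j =
            (if i < k \<or> i = k \<and> j < Suc l then new i j else cell s 3 i j))"
        by (intro runs_RSet) (auto simp: new_def agree_off_def less_Suc_eq)
    qed (use assms ag I in \<open>auto simp: agree_off_def less_Suc_eq\<close>)
  qed (use assms in auto)
  then show ?thesis by (simp add: new_def)
qed

lemma runs_Identity:
  assumes "ivar s 0 = n" and zero: "\<forall>i j. cell s 3 i j = 0"
  shows "runs n Identity s (\<lambda>s'. \<forall>i<n. \<forall>j<n. cell s' 3 i j = of_bool (i = j))"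
  unfolding Identity_def
  by (rule runs_For[where I = "\<lambda>k s'. \<forall>i<n. \<forall>j<n. cell s' 3 i j = of_bool (i = j \<and> i < k)"])
    (use assms in \<open>auto intro!: runs_RSet\<close>)

text \<open>The expression may read the very entry that it replaces, as in \<open>Move\<close>;
  therefore \<open>F\<close> may assume that this entry still has its old value.\<close>

lemma runs_fill_column:
  assumes "ivar s 0 = n"
    and F: "\<And>k s'. k < n \<Longrightarrow> ivar s' 2 = k \<Longrightarrow> agree_off {2} {a} s s' \<Longrightarrow>
      cell s' a k 0 = cell s a k 0 \<Longrightarrow> rval e s' = F k"
  shows "runs n (For 2 (RSet a (IVar 2) (IConst 0) e)) s (\<lambda>s'. \<forall>i<n. cell s' a i 0 = F i)"
proof (rule runs_For[where I = "\<lambda>k s'. \<forall>i<n. cell s' a i 0 = (if i < k then F i else cell s a i 0)"])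
  fix k s'
  assume "k < n" "ivar s' 2 = k"
    "agree_off (insert 2 (mod_ivars (RSet a (IVar 2) (IConst 0) e))) (mod_arrays (RSet a (IVar 2) (IConst 0) e)) s s'"
    "\<forall>i<n. cell s' a i 0 = (if i < k then F i else cell s a i 0)"
  with F[of k s'] show "runs n (RSet a (IVar 2) (IConst 0) e) s'
      (\<lambda>s'. \<forall>i<n. cell s' a i 0 = (if i < Suc k then F i else cell s a i 0))"
    by (intro runs_RSet) (auto simp: less_Suc_eq)
qed (use assms in auto)

lemma runs_AddRow:
  assumes n: "ivar s 0 = n" and m: "ivar s 1 = m"
    and H: "inverse_on n (gram m (cell s 1)) {..<n} (cell s 3)"
  shows "runs n AddRow s (\<lambda>s'. inverse_on n (gram (Suc m) (cell s 1)) {..<n} (cell s' 3))"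
proof -
  let ?sum = "For 3 (Add (RMul (Cell 3 (IVar 2) (IVar 3)) (Cell 1 (IVar 1) (IVar 3))))"
  let ?row = "Seq (SetAcc (RConst 0)) (Seq ?sum (SetW (IVar 2) Acc))"
  let ?dot = "For 3 (Add (RMul (Cell 1 (IVar 1) (IVar 3)) (W (IVar 3))))"
  define v where "v i = (\<Sum>j<n. cell s 3 i j * cell s 1 m j)" for i
  define d where "d = 1 + (\<Sum>j<n. cell s 1 m j * v j)"
  have v: "runs n (For 2 ?row) s (\<lambda>s'. \<forall>i<n. cell s' 4 i 0 = v i)"
  proof (rule runs_For[where I = "\<lambda>k s'. \<forall>i<k. cell s' 4 i 0 = v i"])
    fix k s'
    assume k: "k < n" "ivar s' 2 = k" and I: "\<forall>i<k. cell s' 4 i 0 = v i"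
      and ag: "agree_off (insert 2 (mod_ivars ?row)) (mod_arrays ?row) s s'"
    let ?s = "set_cell 5 0 0 0 s'"
    have "adds n ?sum
        (\<lambda>s. \<Sum>j<n. rval (RMul (Cell 3 (IVar 2) (IVar 3)) (Cell 1 (IVar 1) (IVar 3))) (set_ivar 3 j s))"
      by (intro adds_For adds_Add) (auto simp: agree_off_def)
    then have sum: "runs n ?sum ?s
        (\<lambda>s''. cell s'' 5 0 0 = cell ?s 5 0 0 + v k)"
      by (rule runs_adds) (use ag n m k in \<open>auto simp: agree_off_def v_def\<close>)
    have "runs n (Seq ?sum
         (SetW (IVar 2) Acc)) ?s (\<lambda>s'. \<forall>i<Suc k. cell s' 4 i 0 = v i)"
      by (rule runs_Seq[OF sum], rule runs_RSet) (use I k in \<open>auto simp: agree_off_def less_Suc_eq\<close>)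
    then show "runs n ?row s' (\<lambda>s'. \<forall>i<Suc k. cell s' 4 i 0 = v i)"
      by (intro runs_RSet_Seq) simp
  qed (use n in auto)
  have d: "runs n ?dot s'
      (\<lambda>s''. cell s'' 5 0 0 = cell s' 5 0 0 + (d - 1))"
    if "agree_off {2, 3} {4, 5} s s'" "\<forall>i<n. cell s' 4 i 0 = v i" for s'
  proof -
    have "adds n ?dot
        (\<lambda>s. \<Sum>j<n. rval (RMul (Cell 1 (IVar 1) (IVar 3)) (W (IVar 3))) (set_ivar 3 j s))"
      by (intro adds_For adds_Add) (auto simp: agree_off_def)
    then show ?thesis
      by (rule runs_adds) (use that n m in \<open>auto simp: agree_off_def d_def\<close>)
  qed
  show ?thesis
    unfolding AddRow_def
  proof (rule runs_Seq[OF v])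
    fix s1 assume s1: "\<forall>i<n. cell s1 4 i 0 = v i"
      and "agree_off (mod_ivars (For 2 ?row)) (mod_arrays (For 2 ?row)) s s1"
    then have ag1: "agree_off {2, 3} {4, 5} s s1" by (simp add: agree_off_def)
    let ?s = "set_cell 5 0 0 1 s1"
    have ag2: "agree_off {2, 3} {4, 5} s ?s" "\<forall>i<n. cell ?s 4 i 0 = v i"
      using ag1 s1 by (auto simp: agree_off_def fun_eq_iff)
    have "runs n (Seq ?dot RankOne) ?s
        (\<lambda>s'. inverse_on n (gram (Suc m) (cell s 1)) {..<n} (cell s' 3))"
    proof (rule runs_Seq[OF d[OF ag2]])
      fix s2 assume s2: "cell s2 5 0 0 = cell ?s 5 0 0 + (d - 1)"
        and "agree_off (mod_ivars ?dot) (mod_arrays ?dot) ?s s2"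
      then have ag3: "agree_off {2, 3} {4, 5} s s2" "\<forall>i<n. cell s2 4 i 0 = v i"
        using ag2 s1 by (auto simp: agree_off_def)
      then have "ivar s2 0 = n" using n by (simp add: agree_off_def)
      from runs_RankOne[OF this]
      show "runs n RankOne s2 (\<lambda>s'. inverse_on n (gram (Suc m) (cell s 1)) {..<n} (cell s' 3))"
      proof (rule runs_frame)
        fix s3 assume "\<forall>i<n. \<forall>j<n. cell s3 3 i j = cell s2 3 i j - cell s2 4 i 0 * cell s2 4 j 0 / cell s2 5 0 0"
        then show "inverse_on n (gram (Suc m) (cell s 1)) {..<n} (cell s3 3)"
          using ag3 s2
          by (intro inverse_on_gram_Suc[OF H v_def d_def]) (auto simp: agree_off_def)
      qed
    qed
    then show "runs n (Seq (SetAcc (RConst 1))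
       (Seq ?dot RankOne)) s1
        (\<lambda>s'. inverse_on n (gram (Suc m) (cell s 1)) {..<n} (cell s' 3))"
      by (intro runs_RSet_Seq) simp
  qed
qed

lemma runs_Slope:
  assumes n: "ivar s 0 = n" and p: "ivar s 1 = p"
  shows "runs n Slope s (\<lambda>s'. cell s' 5 0 0 = bilin n (pullback n (cell s 1) (cell s 0))
      (\<lambda>i. cell s 3 p p * cell s 2 i 0 - cell s 2 p 0 * cell s 3 i p) (\<lambda>i. cell s 3 i p))"
    (is "runs n Slope s (\<lambda>s'. cell s' 5 0 0 = ?g)")
proof -
  let ?e = "RMul (RSub (RMul (Cell 3 (IVar 1) (IVar 1)) (X (IVar 2)))
                 (RMul (X (IVar 1)) (Cell 3 (IVar 2) (IVar 1))))
       (RMul (RMul (RMul (Cell 1 (IVar 4) (IVar 2)) (Cell 0 (IVar 4) (IVar 5)))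
                   (Cell 1 (IVar 5) (IVar 3)))
             (Cell 3 (IVar 3) (IVar 1)))"
  let ?s = "set_cell 5 0 0 0 s"
  have "adds n (For 2 (For 3 (For 4 (For 5 (Add ?e))))) (\<lambda>s. \<Sum>i<n. \<Sum>j<n. \<Sum>k<n. \<Sum>l<n.
      rval ?e (set_ivar 5 l (set_ivar 4 k (set_ivar 3 j (set_ivar 2 i s)))))"
    by (intro adds_For adds_Add) (auto simp: agree_off_def)
  then have "runs n (For 2 (For 3 (For 4 (For 5 (Add ?e))))) ?s (\<lambda>s'. cell s' 5 0 0 = cell ?s 5 0 0 + ?g)"
    by (rule runs_adds)
      (use n p in \<open>simp_all add: bilin_def pullback_def sum_distrib_left sum_distrib_right mult.assoc\<close>)
  then show ?thesis
    unfolding Slope_def by (intro runs_RSet_Seq) simp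
qed

lemma runs_Direct:
  assumes "ivar s 0 = n" "ivar s 1 = p"
  shows "runs n (Direct \<sigma>) s (\<lambda>s'. (\<forall>i<n. cell s' 4 i 0 = of_int \<sigma> * cell s 3 i p) \<and>
    cell s' 6 0 0 = (1 - of_int \<sigma> * cell s 2 p 0) / cell s 3 p p)"
  unfolding Direct_def
proof (rule runs_Seq)
  show "runs n (For 2 (SetW (IVar 2) (RMul (RConst \<sigma>) (Cell 3 (IVar 2) (IVar 1))))) s
      (\<lambda>s'. \<forall>i<n. cell s' 4 i 0 = of_int \<sigma> * cell s 3 i p)"
    by (rule runs_fill_column) (use assms in \<open>auto simp: agree_off_def\<close>)
qed (use assms in \<open>auto simp: agree_off_def intro!: runs_RSet\<close>)

section \<open>Step lengths that stay inside the cube\<close>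

lemma abs_add_mult_le_1:
  fixes a v :: real
  assumes "\<bar>a\<bar> \<le> 1" "\<bar>a + \<delta> * v\<bar> \<le> 1" "0 \<le> \<delta>'" "\<delta>' \<le> \<delta>"
  shows "\<bar>a + \<delta>' * v\<bar> \<le> 1"
proof (cases "0 \<le> v")
  case True
  then have "0 \<le> \<delta>' * v" "\<delta>' * v \<le> \<delta> * v" using assms by (simp_all add: mult_right_mono)
  then show ?thesis using assms by linarith
next
  case False
  then have "\<delta>' * v \<le> 0" "\<delta> * v \<le> \<delta>' * v"
    using assms by (simp_all add: mult_right_mono_neg mult_nonneg_nonpos)
  then show ?thesis using assms by linarith
qed

text \<open>The sign \<open>\<sigma>\<close> names the face that is crossed, so both branches of
  \<open>Scan\<close> are covered; \<open>(\<sigma> - a) / v\<close> is the step length at which the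
  crossing happens.\<close>

lemma step_shrink:
  fixes a v \<sigma> :: real
  assumes a: "\<bar>a\<bar> \<le> 1" and \<sigma>: "\<sigma> = 1 \<or> \<sigma> = -1" and "0 \<le> \<delta>" and out: "1 < \<sigma> * (a + \<delta> * v)"
  shows "v \<noteq> 0" "0 \<le> (\<sigma> - a) / v" "(\<sigma> - a) / v \<le> \<delta>" "a + (\<sigma> - a) / v * v = \<sigma>"
proof -
  have "0 < \<delta> * (\<sigma> * v)" using a \<sigma> out by (auto simp: algebra_simps)
  then have v: "0 < \<sigma> * v" using \<open>0 \<le> \<delta>\<close> by (simp add: zero_less_mult_iff)
  then show "v \<noteq> 0" by auto
  then show "a + (\<sigma> - a) / v * v = \<sigma>" by simp
  show "0 \<le> (\<sigma> - a) / v" "(\<sigma> - a) / v \<le> \<delta>"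
    using \<sigma> a v out by (auto simp: field_simps)
qed

text \<open>Shrinking the step length preserves the constraints of the coordinates already scanned, since
  \<open>x\<close> itself satisfies them.\<close>

lemma runs_Scan:
  assumes n: "ivar s 0 = n" and p: "ivar s 1 = p" "p < n" "v p \<noteq> 0"
    and xv: "\<And>i. i < n \<Longrightarrow> cell s 2 i 0 = x i" "\<And>i. i < n \<Longrightarrow> cell s 4 i 0 = v i"
    and x: "\<And>i. i < n \<Longrightarrow> \<bar>x i\<bar> \<le> 1"
    and \<delta>: "0 \<le> cell s 6 0 0" "\<bar>x p + cell s 6 0 0 * v p\<bar> = 1"
  shows "runs n Scan s (\<lambda>s'. 0 \<le> cell s' 6 0 0 \<and> (\<forall>i<n. \<bar>x i + cell s' 6 0 0 * v i\<bar> \<le> 1) \<and>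
    ivar s' 6 < n \<and> v (ivar s' 6) \<noteq> 0 \<and> \<bar>x (ivar s' 6) + cell s' 6 0 0 * v (ivar s' 6)\<bar> = 1)"
proof -
  \<comment> \<open>The candidate \<open>j\<close> is only required to be below \<open>n\<close>,
    not \<open>k\<close>, since it starts as the pivot. The condition on \<open>v j\<close> will
    show that it is alive.\<close>
  define J where "J k j \<delta> \<longleftrightarrow> 0 \<le> \<delta> \<and> (\<forall>i<k. \<bar>x i + \<delta> * v i\<bar> \<le> 1) \<and>
    j < n \<and> v j \<noteq> 0 \<and> \<bar>x j + \<delta> * v j\<bar> = 1" for k j \<delta>
  have shrink: "J (Suc k) k ((\<sigma> - x k) / v k)"
    if "J k j \<delta>" "k < n" "\<sigma> = 1 \<or> \<sigma> = -1" "1 < \<sigma> * (x k + \<delta> * v k)" for k j \<delta> \<sigma>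
  proof -
    define \<delta>' where "\<delta>' = (\<sigma> - x k) / v k"
    have "0 \<le> \<delta>" using that by (simp add: J_def)
    note st = step_shrink[OF x[OF that(2)] that(3) this that(4), folded \<delta>'_def]
    have "\<bar>x i + \<delta>' * v i\<bar> \<le> 1" if i: "i < k" for i
    proof (rule abs_add_mult_le_1[OF _ _ st(2,3)])
      show "\<bar>x i\<bar> \<le> 1" "\<bar>x i + \<delta> * v i\<bar> \<le> 1"
        using \<open>J k j \<delta>\<close> \<open>k < n\<close> i x[of i] by (simp_all add: J_def)
    qed
    moreover have "\<bar>x k + \<delta>' * v k\<bar> = 1" using that(3) st(4) by auto
    ultimately show ?thesis
      unfolding J_def \<delta>'_def[symmetric] using st(1,2) \<open>k < n\<close> by (auto simp: less_Suc_eq)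
  qed
  show ?thesis
    unfolding Scan_def
  proof (rule runs_Seq[where R = "\<lambda>s'. s' = set_ivar 6 p s"])
    fix s0 assume s0: "s0 = set_ivar 6 p s"
    let ?body = "Cond (RLess (RConst 1) (RAdd (X (IVar 2)) (RMul Step (W (IVar 2)))))
       (Seq (SetStep (RDiv (RSub (RConst 1) (X (IVar 2))) (W (IVar 2)))) (ISet 6 (IVar 2)))
     (Cond (RLess (RAdd (X (IVar 2)) (RMul Step (W (IVar 2)))) (RConst (-1)))
       (Seq (SetStep (RDiv (RSub (RConst (-1)) (X (IVar 2))) (W (IVar 2)))) (ISet 6 (IVar 2)))
     Skip)"
    show "runs n (For 2 ?body) s0 (\<lambda>s'. 0 \<le> cell s' 6 0 0 \<and>
      (\<forall>i<n. \<bar>x i + cell s' 6 0 0 * v i\<bar> \<le> 1) \<and>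
      ivar s' 6 < n \<and> v (ivar s' 6) \<noteq> 0 \<and> \<bar>x (ivar s' 6) + cell s' 6 0 0 * v (ivar s' 6)\<bar> = 1)"
    proof (rule runs_For[where I = "\<lambda>k s'. J k (ivar s' 6) (cell s' 6 0 0)"])
      fix k s' assume k: "k < n" "ivar s' 2 = k"
        and "agree_off (insert 2 (mod_ivars ?body)) (mod_arrays ?body) s0 s'"
        and I: "J k (ivar s' 6) (cell s' 6 0 0)"
      then have c: "cell s' 2 k 0 = x k" "cell s' 4 k 0 = v k"
        using xv[of k] s0 by (auto simp: agree_off_def)
      have upd: "runs n (Seq (SetStep (RDiv (RSub (RConst \<sigma>) (X (IVar 2))) (W (IVar 2)))) (ISet 6 (IVar 2))) s'
          (\<lambda>s'. J (Suc k) (ivar s' 6) (cell s' 6 0 0))"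
        if "\<sigma> = 1 \<or> \<sigma> = -1" "1 < of_int \<sigma> * (x k + cell s' 6 0 0 * v k)" for \<sigma>
        by (rule runs_Seq[OF runs_RSet runs_ISet, where R = "\<lambda>s''. cell s'' 6 0 0 = (of_int \<sigma> - x k) / v k"])
          (use shrink[OF I k(1), of "of_int \<sigma>"] that c k in \<open>auto simp: agree_off_def\<close>)
      show "runs n ?body s' (\<lambda>s'. J (Suc k) (ivar s' 6) (cell s' 6 0 0))"
        by (intro runs_Cond upd runs_Skip) (use k c I in \<open>auto simp: J_def less_Suc_eq\<close>)
    qed (use n p \<delta> s0 in \<open>auto simp: J_def\<close>)
  qed (use p in \<open>auto intro!: runs_ISet\<close>)
qed

lemma runs_Move:
  assumes "ivar s 0 = n"
  shows "runs n Move s (\<lambda>s'. \<forall>i<n. cell s' 2 i 0 = cell s 2 i 0 + cell s 6 0 0 * cell s 4 i 0)"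
  unfolding Move_def
  by (rule runs_fill_column) (use assms in \<open>auto simp: agree_off_def\<close>)

lemma runs_Drop:
  assumes n: "ivar s 0 = n" and j: "ivar s 6 = j" "j < n" and sym: "symm n (cell s 3)"
  shows "runs n Drop s (\<lambda>s'. \<forall>i<n. \<forall>k<n. cell s' 3 i k = downdate (cell s 3) j i k)"
  unfolding Drop_def
proof (rule runs_Seq)
  show "runs n (For 2 (SetW (IVar 2) (Cell 3 (IVar 2) (IVar 6)))) s
      (\<lambda>s'. \<forall>i<n. cell s' 4 i 0 = cell s 3 i j)"
    by (rule runs_fill_column) (use n j in \<open>auto simp: agree_off_def\<close>)
next
  fix s1 assume s1: "\<forall>i<n. cell s1 4 i 0 = cell s 3 i j"
    and ag: "agree_off (mod_ivars (For 2 (SetW (IVar 2) (Cell 3 (IVar 2) (IVar 6)))))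
      (mod_arrays (For 2 (SetW (IVar 2) (Cell 3 (IVar 2) (IVar 6))))) s s1"
  let ?s = "set_cell 5 0 0 (cell s 3 j j) s1"
  have "runs n RankOne ?s (\<lambda>s'. \<forall>i<n. \<forall>k<n. cell s' 3 i k = downdate (cell s 3) j i k)"
    by (rule runs_frame[OF runs_RankOne])
      (use n j s1 ag sym in \<open>auto simp: agree_off_def downdate_def symm_def\<close>)
  then show "runs n (Seq (SetAcc (Cell 3 (IVar 6) (IVar 6))) RankOne) s1
      (\<lambda>s'. \<forall>i<n. \<forall>k<n. cell s' 3 i k = downdate (cell s 3) j i k)"
    using ag j by (intro runs_RSet_Seq) (simp add: agree_off_def)
qed

section \<open>Correctness of the walk\<close>

lemma inverse_on_cong:
  "inverse_on n G A H \<Longrightarrow> (\<And>i j. i < n \<Longrightarrow> j < n \<Longrightarrow> H' i j = H i j) \<Longrightarrow> inverse_on n G A H'"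
  by (auto simp: inverse_on_def symm_def subset_iff)

lemma potential_cong:
  assumes "p < n" "\<And>i j. i < n \<Longrightarrow> j < n \<Longrightarrow> H' i j = H i j" "\<And>i. i < n \<Longrightarrow> x' i = x i"
  shows "potential n M H' p x' = potential n M H p x"
  using assms by (simp add: potential_def trace_prod_def bilin_def)

text \<open>This is where columns of norm at most 1 enter: they keep the diagonal of
  \<open>gram\<close> at most 2.\<close>

lemma inverse_on_diag_ge:
  assumes "inverse_on n G A H" "pos_form n G" "p \<in> A" "0 < G p p" "G p p \<le> 2"
  shows "1/2 \<le> H p p"
proof -
  have "1 \<le> G p p * H p p" using assms by (intro inverse_on_diag)
  moreover from this have "0 < G p p * H p p" by linarith
  then have "0 < H p p" using \<open>0 < G p p\<close> by (rule zero_less_mult_pos)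
  then have "G p p * H p p \<le> 2 * H p p" using assms by (intro mult_right_mono) auto
  ultimately show ?thesis by simp
qed

lemma potential_drop:
  assumes M: "pos_form n M" and H: "inverse_on n G A H"
    and G: "pos_form n G" "\<And>i. i \<in> A \<Longrightarrow> 0 < G i i \<and> G i i \<le> 2"
    and A: "p \<in> A" "j \<in> A" and x: "\<bar>x p\<bar> \<le> 1" "\<bar>x j\<bar> = 1"
  shows "potential n M (downdate H j) p x \<le> potential n M H p x"
proof (cases "j = p")
  case True
  then show ?thesis
    using potential_drop_pivot[OF M] inverse_on_diag_ge[OF H G(1)] G(2) A x by simp
next
  case False
  have diag: "1/2 \<le> H i i" if "i \<in> A" for i using inverse_on_diag_ge[OF H G(1)] G(2) that by simp
  then have j: "0 < H j j" using A(2) by fastforce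
  \<comment> \<open>The new matrix is again the inverse of a block, so the lower bound 1/2 holds for
    its diagonal as well.\<close>
  then have "inverse_on n G (A - {j}) (downdate H j)" using H A by (intro inverse_on_downdate) auto
  from inverse_on_diag_ge[OF this G(1), of p] have "1/2 \<le> downdate H j p p" using G(2) A False by simp
  then show ?thesis
    using H A j diag x by (intro potential_drop_other[OF M]) (auto simp: inverse_on_def)
qed

text \<open>The set \<open>A\<close> exists only in the proof. Alive coordinates may also have
  absolute value 1, because a step drops just one of those that reach the boundary.\<close>

definition walk_inv :: "nat \<Rightarrow> nat set \<Rightarrow> state \<Rightarrow> bool" where
  "walk_inv n A s \<longleftrightarrow> inverse_on n (gram n (cell s 1)) A (cell s 3) \<and>
     (\<forall>i<n. \<bar>cell s 2 i 0\<bar> \<le> 1) \<and> (\<forall>i<n. i \<notin> A \<longrightarrow> \<bar>cell s 2 i 0\<bar> = 1)"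

definition form :: "nat \<Rightarrow> state \<Rightarrow> nat \<Rightarrow> nat \<Rightarrow> real" where
  "form n s = pullback n (cell s 1) (cell s 0)"

definition state_potential :: "nat \<Rightarrow> nat \<Rightarrow> state \<Rightarrow> real" where
  "state_potential n p s = potential n (form n s) (cell s 3) p (\<lambda>i. cell s 2 i 0)"

text \<open>The potential without its pivot term, for use between two pivots.\<close>

definition base_potential :: "nat \<Rightarrow> state \<Rightarrow> real" where
  "base_potential n s = bilin n (form n s) (\<lambda>i. cell s 2 i 0) (\<lambda>i. cell s 2 i 0)
     + 2 * trace_prod n (form n s) (cell s 3)"

definition valid_input :: "nat \<Rightarrow> state \<Rightarrow> bool" where
  "valid_input n s \<longleftrightarrow> ivar s 0 = n \<and> pos_form n (cell s 0) \<and> (\<forall>j<n. gram n (cell s 1) j j \<le> 2)"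

lemma valid_input_agree:
  "valid_input n s \<Longrightarrow> agree_off V A s s' \<Longrightarrow> V \<inter> {0} = {} \<Longrightarrow> A \<inter> {0, 1} = {} \<Longrightarrow>
    valid_input n s' \<and> form n s' = form n s"
  by (simp add: valid_input_def agree_off_def form_def)

lemma gram_diag_ge: "1 \<le> gram k Q i i"
  by (auto simp: gram_def intro!: sum_nonneg)

lemma runs_Walk:
  assumes V: "valid_input n s" and p: "ivar s 1 = p" "p \<in> A" and W: "walk_inv n A s"
  shows "runs n Walk s (\<lambda>s'. \<exists>j\<in>A. walk_inv n (A - {j}) s' \<and>
    state_potential n p s' \<le> state_potential n p s)"
proof -
  define H where "H = cell s 3"
  define Q where "Q = cell s 1"
  define M where "M = form n s"
  define x where "x i = cell s 2 i 0" for i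
  define g where "g = bilin n M (\<lambda>i. H p p * x i - x p * H i p) (\<lambda>i. H i p)"
  have n: "ivar s 0 = n" and M: "pos_form n M"
    using V by (simp_all add: valid_input_def M_def form_def pos_form_pullback)
  have H: "inverse_on n (gram n Q) A H" and x: "\<And>i. i < n \<Longrightarrow> \<bar>x i\<bar> \<le> 1"
    and fixed: "\<And>i. i < n \<Longrightarrow> i \<notin> A \<Longrightarrow> \<bar>x i\<bar> = 1"
    using W by (simp_all add: walk_inv_def H_def Q_def x_def)
  have An: "A \<subseteq> {..<n}" and sym: "symm n H" using H by (simp_all add: inverse_on_def)
  have pn: "p < n" using An p by auto
  have diag: "0 < gram n Q i i" "gram n Q i i \<le> 2" if "i \<in> A" for i
    using V that An gram_diag_ge[of n Q i] by (auto simp: valid_input_def Q_def)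
  have Hpos: "0 < H i i" if "i \<in> A" for i
    using inverse_on_diag_ge[OF H pos_form_gram that diag[OF that]] by simp
  have zero: "H i p = 0" if "i < n" "i \<notin> A" for i using H that pn by (simp add: inverse_on_def)
  define R where "R \<sigma> s' \<longleftrightarrow> agree_off {2, 3, 4, 5, 6} {4, 5, 6} s s' \<and>
    (\<forall>i<n. cell s' 4 i 0 = \<sigma> * H i p) \<and> cell s' 6 0 0 = (1 - \<sigma> * x p) / H p p" for \<sigma> s'
  let ?good = "\<lambda>s'. \<exists>j\<in>A. walk_inv n (A - {j}) s' \<and> state_potential n p s' \<le> state_potential n p s"
  have rest: "runs n (Seq Scan (Seq Move Drop)) s1 ?good"
    if s1: "R \<sigma> s1" and \<sigma>: "\<sigma> = 1 \<or> \<sigma> = -1" and \<sigma>g: "\<sigma> * g \<le> 0" for \<sigma> s1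
  proof (rule runs_Seq)
    define v where "v i = \<sigma> * H i p" for i
    have ag1: "agree_off {2, 3, 4, 5, 6} {4, 5, 6} s s1" using s1 by (simp add: R_def)
    have "0 \<le> (1 - \<sigma> * x p) / H p p"
      using \<sigma> x[OF pn] Hpos[OF p(2)] by (intro divide_nonneg_pos) auto
    \<comment> \<open>The proposed step puts the pivot on the boundary, as \<open>runs_Scan\<close>
      demands.\<close>
    moreover have "x p + (1 - \<sigma> * x p) / H p p * v p = \<sigma>"
      using \<sigma> Hpos[OF p(2)] by (auto simp: v_def field_simps)
    ultimately show "runs n Scan s1 (\<lambda>s'. 0 \<le> cell s' 6 0 0 \<and>
       (\<forall>i<n. \<bar>x i + cell s' 6 0 0 * v i\<bar> \<le> 1) \<and> ivar s' 6 < n \<and> v (ivar s' 6) \<noteq> 0 \<and>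
       \<bar>x (ivar s' 6) + cell s' 6 0 0 * v (ivar s' 6)\<bar> = 1)"
      using s1 n p pn x \<sigma> Hpos[OF p(2)]
      by (intro runs_Scan) (auto simp: R_def agree_off_def x_def v_def)
    fix s2
    assume s2: "0 \<le> cell s2 6 0 0 \<and>
       (\<forall>i<n. \<bar>x i + cell s2 6 0 0 * v i\<bar> \<le> 1) \<and> ivar s2 6 < n \<and> v (ivar s2 6) \<noteq> 0 \<and>
       \<bar>x (ivar s2 6) + cell s2 6 0 0 * v (ivar s2 6)\<bar> = 1"
      and "agree_off (mod_ivars Scan) (mod_arrays Scan) s1 s2"
    then have ag2: "agree_off {2, 3, 4, 5, 6} {4, 5, 6} s s2" and v2: "\<forall>i<n. cell s2 4 i 0 = v i"
      using ag1 s1 by (auto simp: agree_off_def R_def v_def)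
    define \<delta> where "\<delta> = cell s2 6 0 0"
    define j where "j = ivar s2 6"
    define y where "y i = x i + \<delta> * (\<sigma> * H i p)" for i
    have \<delta>: "0 \<le> \<delta>" and y: "\<And>i. i < n \<Longrightarrow> \<bar>y i\<bar> \<le> 1" "\<bar>y j\<bar> = 1" and j: "j < n" "H j p \<noteq> 0"
      using s2 by (auto simp: y_def v_def \<delta>_def j_def)
    \<comment> \<open>Dead coordinates have zero rows in \<open>H\<close> and do not move.\<close>
    have jA: "j \<in> A" using zero j by blast
    have fixed': "\<bar>y i\<bar> = 1" if "i < n" "i \<notin> A - {j}" for i
      using that zero fixed y by (cases "i = j") (auto simp: y_def)
    have "potential n M (downdate H j) p y \<le> potential n M H p y"
      using diag y pn by (intro potential_drop[OF M H pos_form_gram _ p(2) jA]) auto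
    also have "\<dots> \<le> potential n M H p x"
      using \<sigma>g unfolding y_def g_def by (rule potential_move[where H = H and p = p, OF M Hpos[OF p(2)] \<delta>])
    finally have pot: "potential n M (downdate H j) p y \<le> potential n M H p x" .
    have inv: "inverse_on n (gram n Q) (A - {j}) (downdate H j)"
      using Hpos[OF jA] by (intro inverse_on_downdate[OF H jA]) simp
    show "runs n (Seq Move Drop) s2 ?good"
    proof (rule runs_Seq[OF runs_Move])
      show "ivar s2 0 = n" using ag2 n by (simp add: agree_off_def)
      fix s3
      assume s3: "\<forall>i<n. cell s3 2 i 0 = cell s2 2 i 0 + cell s2 6 0 0 * cell s2 4 i 0"
        and "agree_off (mod_ivars Move) (mod_arrays Move) s2 s3"
      then have ag3: "agree_off {2, 3, 4, 5, 6} {2, 4, 5, 6} s s3" and j3: "ivar s3 6 = j"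
        using ag2 by (auto simp: agree_off_def j_def)
      have y3: "cell s3 2 i 0 = y i" if "i < n" for i
        using s3 v2 ag2 that by (simp add: y_def v_def \<delta>_def x_def agree_off_def)
      have H3: "cell s3 3 = H" and n3: "ivar s3 0 = n" using ag3 n by (auto simp: agree_off_def H_def)
      from runs_Drop[OF n3 j3 j(1)] sym H3
      have "runs n Drop s3 (\<lambda>s'. \<forall>i<n. \<forall>k<n. cell s' 3 i k = downdate H j i k)" by simp
      then show "runs n Drop s3 ?good"
      proof (rule runs_frame)
        fix s4
        assume H4: "\<forall>i<n. \<forall>k<n. cell s4 3 i k = downdate H j i k"
          and ag4: "agree_off (mod_ivars Drop) (mod_arrays Drop) s3 s4"
        have y4: "cell s4 2 i 0 = y i" if "i < n" for i
          using y3[OF that] ag4 by (simp add: agree_off_def)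
        have M4: "form n s4 = M" and Q4: "cell s4 1 = Q"
          using ag3 ag4 by (simp_all add: form_def M_def Q_def agree_off_def)
        have "inverse_on n (gram n Q) (A - {j}) (cell s4 3)"
          using H4 by (intro inverse_on_cong[OF inv]) simp
        then have "walk_inv n (A - {j}) s4"
          unfolding walk_inv_def Q4 using y(1) fixed' by (simp add: y4)
        moreover have "state_potential n p s4 = potential n M (downdate H j) p y"
          unfolding state_potential_def M4 using H4 y4 by (intro potential_cong[OF pn]) simp_all
        then have "state_potential n p s4 \<le> state_potential n p s"
          using pot unfolding state_potential_def M_def H_def x_def[abs_def] by simp
        ultimately show "?good s4" using jA by blast
      qed
    qed
  qed
  show ?thesis
    unfolding Walk_def
  proof (rule runs_Seq[OF runs_Slope[OF n p(1)]])
    fix s0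
    assume "cell s0 5 0 0 = bilin n (pullback n (cell s 1) (cell s 0))
        (\<lambda>i. cell s 3 p p * cell s 2 i 0 - cell s 2 p 0 * cell s 3 i p) (\<lambda>i. cell s 3 i p)"
      and ag: "agree_off (mod_ivars Slope) (mod_arrays Slope) s s0"
    then have g: "cell s0 5 0 0 = g" by (simp add: g_def M_def form_def H_def x_def)
    have np: "ivar s0 0 = n" "ivar s0 1 = p" using ag n p by (simp_all add: agree_off_def)
    have dir: "runs n (Direct \<sigma>) s0 (\<lambda>s1. R (of_int \<sigma>) s1)" for \<sigma>
      by (rule runs_frame[OF runs_Direct[OF np]])
        (use ag in \<open>auto simp: R_def agree_off_def H_def x_def\<close>)
    show "runs n (Seq (Cond (RLess (RConst 0) Acc) (Direct (-1)) (Direct 1)) (Seq Scan (Seq Move Drop))) s0 ?good"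
    proof (rule runs_Seq)
      show "runs n (Cond (RLess (RConst 0) Acc) (Direct (-1)) (Direct 1)) s0
          (\<lambda>s1. \<exists>\<sigma>. R \<sigma> s1 \<and> (\<sigma> = 1 \<or> \<sigma> = -1) \<and> \<sigma> * g \<le> 0)"
      proof (rule runs_Cond)
        assume "bval (RLess (RConst 0) Acc) s0"
        then show "runs n (Direct (-1)) s0 (\<lambda>s1. \<exists>\<sigma>. R \<sigma> s1 \<and> (\<sigma> = 1 \<or> \<sigma> = -1) \<and> \<sigma> * g \<le> 0)"
          using g by (intro runs_frame[OF dir] exI[of _ "-1"]) auto
      next
        assume "\<not> bval (RLess (RConst 0) Acc) s0"
        then show "runs n (Direct 1) s0 (\<lambda>s1. \<exists>\<sigma>. R \<sigma> s1 \<and> (\<sigma> = 1 \<or> \<sigma> = -1) \<and> \<sigma> * g \<le> 0)"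
          using g by (intro runs_frame[OF dir] exI[of _ 1]) auto
      qed
    qed (use rest in blast)
  qed
qed

text \<open>The variant is the number of alive coordinates, which every step lowers by one. The
  potential starts below \<open>base_potential\<close> and coincides with it again once the pivot is
  dead.\<close>

lemma runs_Pivot:
  assumes V: "valid_input n s" and p: "ivar s 1 = p" "p < n"
    and W: "walk_inv n A s" "A \<subseteq> {p..<n}" and b: "base_potential n s \<le> K"
  shows "runs n (Loop (RLess (RConst 0) (Cell 3 (IVar 1) (IVar 1))) Walk) s
    (\<lambda>s'. \<exists>A. walk_inv n A s' \<and> A \<subseteq> {Suc p..<n} \<and> base_potential n s' \<le> K)"
proof -
  let ?b = "RLess (RConst 0) (Cell 3 (IVar 1) (IVar 1))"
  define J where "J m s' \<longleftrightarrow> valid_input n s' \<and> ivar s' 1 = p \<and>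
    (\<exists>A. walk_inv n A s' \<and> A \<subseteq> {p..<n} \<and> card A = m \<and> state_potential n p s' \<le> K)" for m s'
  have "runs n (Loop ?b Walk) s (\<lambda>s'. \<not> bval ?b s' \<and> (\<exists>m. J m s'))"
  proof (rule runs_Loop[where m = "card A"])
    have "pos_form n (form n s)" using V by (simp add: valid_input_def form_def pos_form_pullback)
    then have "state_potential n p s \<le> base_potential n s"
      by (simp add: state_potential_def base_potential_def potential_le)
    then show "J (card A) s" using assms by (auto simp: J_def)
    show "card A \<le> n" using card_mono[OF _ W(2)] by simp
  next
    fix m s' assume "J m s'" "bval ?b s'"
    then obtain A' where A': "walk_inv n A' s'" "A' \<subseteq> {p..<n}" "card A' = m"
        "state_potential n p s' \<le> K"
      and s': "valid_input n s'" "ivar s' 1 = p" "0 < cell s' 3 p p"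
      by (auto simp: J_def)
    then have pA: "p \<in> A'" using p by (force simp: walk_inv_def inverse_on_def)
    have fin: "finite A'" using A'(2) finite_subset by blast
    have "runs n Walk s' (J (m - 1))"
    proof (rule runs_frame[OF runs_Walk[OF s'(1,2) pA A'(1)]])
      fix s'' assume ag: "agree_off (mod_ivars Walk) (mod_arrays Walk) s' s''"
        and "\<exists>j\<in>A'. walk_inv n (A' - {j}) s'' \<and> state_potential n p s'' \<le> state_potential n p s'"
      then obtain j where j: "j \<in> A'" "walk_inv n (A' - {j}) s''"
        "state_potential n p s'' \<le> state_potential n p s'" by blast
      have "valid_input n s''" using valid_input_agree[OF s'(1) ag] by simp
      moreover have "ivar s'' 1 = p" using ag s' by (simp add: agree_off_def)
      moreover have "card (A' - {j}) = m - 1" using j A' fin by simp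
      ultimately show "J (m - 1) s''"
        unfolding J_def using j A' by (intro conjI exI[of _ "A' - {j}"]) auto
    qed
    moreover have "0 < m" using pA fin A'(3) by (auto simp: card_gt_0_iff)
    ultimately show "\<exists>m'<m. runs n Walk s' (J m')" by (intro exI[of _ "m - 1"]) simp
  qed
  then show ?thesis
  proof (rule runs_frame)
    fix s' assume "\<not> bval ?b s' \<and> (\<exists>m. J m s')"
    then obtain A' where A': "walk_inv n A' s'" "A' \<subseteq> {p..<n}" "state_potential n p s' \<le> K"
      and V': "valid_input n s'" and np: "\<not> 0 < cell s' 3 p p"
      by (auto simp: J_def)
    \<comment> \<open>An alive pivot would have a diagonal entry of at least 1/2, contradicting the
      exit test.\<close>
    have pA: "p \<notin> A'"
    proof
      assume "p \<in> A'"
      then have "1/2 \<le> cell s' 3 p p"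
        using A' V' p gram_diag_ge[of n "cell s' 1" p]
        by (intro inverse_on_diag_ge[OF _ pos_form_gram[of n n "cell s' 1"]]) (auto simp: walk_inv_def valid_input_def)
      with np show False by simp
    qed
    then have "cell s' 3 p p = 0" using A' p by (simp add: walk_inv_def inverse_on_def)
    \<comment> \<open>The pivot term is a quotient with denominator 0, hence 0.\<close>
    then have "state_potential n p s' = base_potential n s'"
      by (simp add: state_potential_def base_potential_def potential_def)
    moreover have "A' \<subseteq> {Suc p..<n}"
    proof
      fix i assume "i \<in> A'"
      with A' pA show "i \<in> {Suc p..<n}" by (cases "i = p") auto
    qed
    ultimately show "\<exists>A. walk_inv n A s' \<and> A \<subseteq> {Suc p..<n} \<and> base_potential n s' \<le> K"
      using A' by auto
  qed
qed

lemma runs_Program: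
  assumes V: "valid_input n s" and zero: "\<And>i j. cell s 2 i j = 0" "\<And>i j. cell s 3 i j = 0"
  shows "runs n Program s (\<lambda>s'. (\<forall>i<n. \<bar>cell s' 2 i 0\<bar> = 1) \<and>
    bilin n (form n s) (\<lambda>i. cell s' 2 i 0) (\<lambda>i. cell s' 2 i 0) \<le> 2 * (\<Sum>i<n. cell s 0 i i))"
proof -
  define K where "K = 2 * (\<Sum>i<n. cell s 0 i i)"
  have n: "ivar s 0 = n" and B: "pos_form n (cell s 0)" using V by (simp_all add: valid_input_def)
  let ?loop = "Loop (RLess (RConst 0) (Cell 3 (IVar 1) (IVar 1))) Walk"
  have walk: "runs n (For 1 ?loop) s2 (\<lambda>s'. (\<forall>i<n. \<bar>cell s' 2 i 0\<bar> = 1) \<and>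
      bilin n (form n s) (\<lambda>i. cell s' 2 i 0) (\<lambda>i. cell s' 2 i 0) \<le> K)"
    if ag: "agree_off {1, 2, 3} {3, 4, 5} s s2"
      and H: "inverse_on n (gram n (cell s 1)) {..<n} (cell s2 3)" for s2
  proof (rule runs_For[where I = "\<lambda>p s'. \<exists>A. walk_inv n A s' \<and> A \<subseteq> {p..<n} \<and> base_potential n s' \<le> K"])
    have V2: "valid_input n s2" "form n s2 = form n s" using valid_input_agree[OF V ag] by auto
    show "ivar s2 0 = n" using V2 by (simp add: valid_input_def)
    have x0: "cell s2 2 i 0 = 0" for i using ag zero by (simp add: agree_off_def)
    \<comment> \<open>At the origin all coordinates are alive and only the trace term
      contributes.\<close>
    have "walk_inv n {..<n} s2" using H ag x0 by (simp add: walk_inv_def agree_off_def)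
    moreover have "trace_prod n (form n s) (cell s2 3) \<le> (\<Sum>i<n. cell s 0 i i)"
      unfolding form_def by (rule trace_prod_pullback_le[OF H B])
    then have "base_potential n s2 \<le> K"
      by (simp add: base_potential_def V2 x0 K_def bilin_def)
    ultimately show "\<exists>A. walk_inv n A s2 \<and> A \<subseteq> {0..<n} \<and> base_potential n s2 \<le> K"
      by (intro exI[of _ "{..<n}"]) auto
    show "\<exists>A. walk_inv n A (set_ivar 1 m s') \<and> A \<subseteq> {k..<n} \<and> base_potential n (set_ivar 1 m s') \<le> K"
      if "\<exists>A. walk_inv n A s' \<and> A \<subseteq> {k..<n} \<and> base_potential n s' \<le> K" for k m s'
      using that by (simp add: walk_inv_def base_potential_def form_def)
    show "runs n ?loop s' (\<lambda>s'. \<exists>A. walk_inv n A s' \<and> A \<subseteq> {Suc p..<n} \<and> base_potential n s' \<le> K)"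
      if "p < n" "ivar s' 1 = p" "agree_off (insert 1 (mod_ivars ?loop)) (mod_arrays ?loop) s2 s'"
        "\<exists>A. walk_inv n A s' \<and> A \<subseteq> {p..<n} \<and> base_potential n s' \<le> K" for p s'
    proof -
      have "valid_input n s'" using valid_input_agree[OF V2(1) that(3)] by simp
      with that show ?thesis using runs_Pivot by blast
    qed
    show "(\<forall>i<n. \<bar>cell s' 2 i 0\<bar> = 1) \<and>
        bilin n (form n s) (\<lambda>i. cell s' 2 i 0) (\<lambda>i. cell s' 2 i 0) \<le> K"
      if ag': "agree_off (insert 1 (mod_ivars ?loop)) (mod_arrays ?loop) s2 s'"
        and I: "\<exists>A. walk_inv n A s' \<and> A \<subseteq> {n..<n} \<and> base_potential n s' \<le> K" for s'
    proof -
      \<comment> \<open>No coordinate below \<open>n\<close> is left, so \<open>H\<close> vanishes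
        and the base potential is just the form at the final point.\<close>
      from I have W: "walk_inv n {} s'" and b: "base_potential n s' \<le> K" by auto
      have "form n s' = form n s" using valid_input_agree[OF V2(1) ag'] V2 by simp
      moreover have "trace_prod n (form n s') (cell s' 3) = 0"
        using W by (simp add: walk_inv_def inverse_on_def trace_prod_def)
      ultimately show ?thesis using W b by (simp add: walk_inv_def base_potential_def)
    qed
  qed auto
  have addrows: "runs n (For 1 AddRow) s1 (\<lambda>s'. inverse_on n (gram n (cell s 1)) {..<n} (cell s' 3))"
    if ag: "agree_off {2} {3} s s1" and H: "\<forall>i<n. \<forall>j<n. cell s1 3 i j = of_bool (i = j)" for s1
  proof (rule runs_For[where I = "\<lambda>m s'. inverse_on n (gram m (cell s 1)) {..<n} (cell s' 3)"])
    show "ivar s1 0 = n" using ag n by (simp add: agree_off_def)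
    show "inverse_on n (gram 0 (cell s 1)) {..<n} (cell s1 3)" using H by (intro inverse_on_gram_0) auto
    show "runs n AddRow s' (\<lambda>s'. inverse_on n (gram (Suc m) (cell s 1)) {..<n} (cell s' 3))"
      if "ivar s' 1 = m" "agree_off (insert 1 (mod_ivars AddRow)) (mod_arrays AddRow) s1 s'"
        "inverse_on n (gram m (cell s 1)) {..<n} (cell s' 3)" for m s'
      using runs_AddRow[of s' n m] that ag n by (simp add: agree_off_def)
  qed auto
  show ?thesis
    unfolding Program_def K_def[symmetric]
  proof (rule runs_Seq[OF runs_Identity])
    fix s1
    assume "\<forall>i<n. \<forall>j<n. cell s1 3 i j = of_bool (i = j)"
      and ag: "agree_off (mod_ivars Identity) (mod_arrays Identity) s s1"
    then have "runs n (For 1 AddRow) s1 (\<lambda>s'. inverse_on n (gram n (cell s 1)) {..<n} (cell s' 3))"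
      by (intro addrows) auto
    then show "runs n (Seq (For 1 AddRow) (For 1 ?loop)) s1 (\<lambda>s'. (\<forall>i<n. \<bar>cell s' 2 i 0\<bar> = 1) \<and>
      bilin n (form n s) (\<lambda>i. cell s' 2 i 0) (\<lambda>i. cell s' 2 i 0) \<le> K)"
    proof (rule runs_Seq)
      fix s2
      assume H: "inverse_on n (gram n (cell s 1)) {..<n} (cell s2 3)"
        and "agree_off (mod_ivars (For 1 AddRow)) (mod_arrays (For 1 AddRow)) s1 s2"
      with ag have "agree_off {1, 2, 3} {3, 4, 5} s s2" by (simp add: agree_off_def)
      then show "runs n (For 1 ?loop) s2 (\<lambda>s'. (\<forall>i<n. \<bar>cell s' 2 i 0\<bar> = 1) \<and>
          bilin n (form n s) (\<lambda>i. cell s' 2 i 0) (\<lambda>i. cell s' 2 i 0) \<le> K)"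
        using H by (rule walk)
    qed
  qed (use n zero in auto)
qed

section \<open>Transfer to vectors and matrices\<close>

lemma scalar_prod_mult_mat_vec:
  assumes "B \<in> carrier_mat n n" "v \<in> carrier_vec n" "w \<in> carrier_vec n"
    and "\<And>i j. i < n \<Longrightarrow> j < n \<Longrightarrow> b i j = B $$ (i, j)"
  shows "v \<bullet> (B *\<^sub>v w) = bilin n b (\<lambda>i. v $ i) (\<lambda>j. w $ j)"
  using assms by (simp add: scalar_prod_def bilin_def sum_distrib_left mult.assoc lessThan_atLeast0)

lemma valid_input_state:
  assumes B: "psd n B" and Q: "Q \<in> carrier_mat n n" "\<forall>j<n. euclid_norm (col Q j) \<le> 1"
  shows "valid_input n (input_state n B Q)"
proof -
  let ?s = "input_state n B Q"
  have Bc: "B \<in> carrier_mat n n" using B by (simp add: psd_def)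
  have "symm n (cell ?s 0)"
    unfolding symm_def
  proof (intro allI impI)
    fix i j assume "i < n" "j < n"
    then have "B $$ (i, j) = transpose_mat B $$ (j, i)" using Bc by simp
    also have "transpose_mat B = B" using B by (simp add: psd_def)
    finally show "cell ?s 0 i j = cell ?s 0 j i" using \<open>i < n\<close> \<open>j < n\<close> by (simp add: input_state_def)
  qed
  moreover have "0 \<le> bilin n (cell ?s 0) z z" for z
  proof -
    have "0 \<le> vec n z \<bullet> (B *\<^sub>v vec n z)" using B by (simp add: psd_def)
    also have "\<dots> = bilin n (cell ?s 0) (\<lambda>i. vec n z $ i) (\<lambda>i. vec n z $ i)"
      using Bc by (intro scalar_prod_mult_mat_vec) (auto simp: input_state_def)
    also have "\<dots> = bilin n (cell ?s 0) z z" by (intro bilin_cong) auto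
    finally show ?thesis .
  qed
  moreover have "gram n (cell ?s 1) j j \<le> 2" if "j < n" for j
  proof -
    have "col Q j \<bullet> col Q j \<le> 1" using Q(2) that by (simp add: euclid_norm_def)
    then show ?thesis
      using Q(1) that by (simp add: gram_def input_state_def scalar_prod_def lessThan_atLeast0)
  qed
  ultimately show ?thesis by (simp add: valid_input_def pos_form_def input_state_def)
qed

theorem theoremA1:
  shows "\<exists>C::real. C > 0 \<and> (\<exists>alg :: com.
    solves_in_poly_time alg
      (\<lambda>n B Q. psd n B \<and> (\<forall>j<n. euclid_norm (col Q j) \<le> 1))
      (\<lambda>n B Q x. x \<in> sign_vecs n \<and>
         norm_wrt B (Q *\<^sub>v x) \<le> C * sqrt (trace_mat B)))"
proof (intro exI conjI)
  \<comment> \<open>The squared norm is bounded by twice the trace.\<close>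
  show "sqrt 2 > (0::real)" by simp
  obtain P :: "nat poly" where P: "\<And>n. poly P n = time_bound Program n"
    using time_bound_poly by blast
  show "solves_in_poly_time Program
      (\<lambda>n B Q. psd n B \<and> (\<forall>j<n. euclid_norm (col Q j) \<le> 1))
      (\<lambda>n B Q x. x \<in> sign_vecs n \<and> norm_wrt B (Q *\<^sub>v x) \<le> sqrt 2 * sqrt (trace_mat B))"
    unfolding solves_in_poly_time_def
  proof (intro exI[of _ P] allI ballI impI)
    fix n and B Q :: "real mat"
    assume B: "B \<in> carrier_mat n n" and Q: "Q \<in> carrier_mat n n"
      and inst: "psd n B \<and> (\<forall>j<n. euclid_norm (col Q j) \<le> 1)"
    let ?s = "input_state n B Q"
    have V: "valid_input n ?s" using inst Q valid_input_state by blast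
    have "runs n Program ?s (\<lambda>s'. (\<forall>i<n. \<bar>cell s' 2 i 0\<bar> = 1) \<and>
      bilin n (form n ?s) (\<lambda>i. cell s' 2 i 0) (\<lambda>i. cell s' 2 i 0) \<le> 2 * (\<Sum>i<n. cell ?s 0 i i))"
      by (rule runs_Program[OF V]) (simp_all add: input_state_def)
    then obtain t s' where t: "exec Program ?s t s'" "t \<le> poly P n"
      and x: "\<forall>i<n. \<bar>cell s' 2 i 0\<bar> = 1"
      and le: "bilin n (form n ?s) (\<lambda>i. cell s' 2 i 0) (\<lambda>i. cell s' 2 i 0) \<le> 2 * (\<Sum>i<n. cell ?s 0 i i)"
      unfolding runs_def P by blast
    define x where "x = output_vec n s'"
    have xc: "x \<in> carrier_vec n" and xi: "\<And>i. i < n \<Longrightarrow> x $ i = cell s' 2 i 0"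
      by (simp_all add: x_def output_vec_def)
    have "x \<in> sign_vecs n" using x xc xi by (auto simp: sign_vecs_def abs_eq_iff')
    moreover have "norm_wrt B (Q *\<^sub>v x) \<le> sqrt 2 * sqrt (trace_mat B)"
    proof -
      have Qx: "(\<Sum>j<n. cell ?s 1 i j * cell s' 2 j 0) = (Q *\<^sub>v x) $ i" if "i < n" for i
        using that Q xc xi by (simp add: scalar_prod_def input_state_def lessThan_atLeast0)
      have "(Q *\<^sub>v x) \<bullet> (B *\<^sub>v (Q *\<^sub>v x)) =
          bilin n (cell ?s 0) (\<lambda>i. (Q *\<^sub>v x) $ i) (\<lambda>i. (Q *\<^sub>v x) $ i)"
        using B Q xc by (intro scalar_prod_mult_mat_vec) (auto simp: input_state_def)
      also have "\<dots> = bilin n (form n ?s) (\<lambda>i. cell s' 2 i 0) (\<lambda>i. cell s' 2 i 0)"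
        unfolding form_def bilin_pullback by (intro bilin_cong Qx[symmetric])
      also have "\<dots> \<le> 2 * trace_mat B"
        using le B by (simp add: trace_mat_def input_state_def)
      finally show ?thesis
        unfolding norm_wrt_def real_sqrt_mult[symmetric] by (rule real_sqrt_le_mono)
    qed
    ultimately show "\<exists>x. returns_within Program (poly P n) n B Q x \<and>
        x \<in> sign_vecs n \<and> norm_wrt B (Q *\<^sub>v x) \<le> sqrt 2 * sqrt (trace_mat B)"
      using t unfolding returns_within_def x_def by blast
  qed
qed

end
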